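(* Let $A_1,\ldots,A_n\subset\mathbb{R}^n$ be finite nonempty sets of sizes $t_1,\ldots,t_n$, and let $\mathfrak{f}=(\mathfrak{f}_1,\ldots,\mathfrak{f}_n)$ be the system of $n$ random fewnomials $$\mathfrak{f}_k=\sum_{\alpha\in A_k}\mathfrak{f}_{k,\alpha}X^\alpha\qquad(k=1,\ldots,n),$$ where the $\mathfrak{f}_{k,\alpha}$ ($1\le k\le n$, $\alpha\in A_k$) are independent centered Gaussian random variables with positive variances $\mathtt{v}_{k,\alpha}$. Let $P_k:=\operatorname{conv}(A_k)$. Assume that: (VM1) for all $k$ and all $\alpha\in A_k$, $\mathtt{v}_{k,\alpha}\le 1$; (VM2) for all $k$ and all $\alpha\in A_k$ that are vertices of the polytope $P_k$, $\mathtt{v}_{k,\alpha}=1$. Then $$\mathbb{E}_{\mathfrak{f}}\,\#\mathcal{Z}_r(\mathfrak{f},\mathbb{R}^n_+)\le\frac{1}{4^n}\,\mathsf{V}\!\left(\sum_{k=1}^nP_k\right)\prod_{k=1}^n(t_k-1),$$ where $\mathsf{V}\left(\sum_{k=1}^nP_k\right)$ is the number of vertices of the Minkowski sum $\sum_{k=1}^nP_k$.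
   Context: $n\geq 1$ is an integer and $\mathbb{R}^n_+=\{x\in\mathbb{R}^n: x_i>0\text{ for all }i\}$. For $\alpha\in\mathbb{R}^n$ and $x\in\mathbb{R}^n_+$, $x^\alpha=\prod_{i=1}^n x_i^{\alpha_i}$. $\mathcal{Z}_r(\mathfrak{f},\mathbb{R}^n_+)$ is the set of regular zeros of $\mathfrak{f}$ in $\mathbb{R}^n_+$, i.e., the points $x\in\mathbb{R}^n_+$ with $\mathfrak{f}(x)=0$ and Jacobian determinant $\det \mathrm{D}_x\mathfrak{f}\neq0$. *)

theory Defs
  imports "HOL-Probability.Probability"
begin

definition positive_orthant :: "(real ^ 'n) set" where
  "positive_orthant = {x. \<forall>i. x $ i > 0}"

(* Real exponents.  Only meaningful on the positive orthant, since powr takes junk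
   values at nonpositive bases. *)
definition monomial_fun :: "real ^ 'n \<Rightarrow> real ^ 'n \<Rightarrow> real" where
  "monomial_fun \<alpha> x = (\<Prod>i\<in>UNIV. (x $ i) powr (\<alpha> $ i))"

(* The k-th component has support A k; the values c k \<alpha> with \<alpha> outside A k are ignored. *)
definition fewnomial_system ::
    "('n \<Rightarrow> (real ^ 'n) set) \<Rightarrow> ('n \<Rightarrow> real ^ 'n \<Rightarrow> real) \<Rightarrow> real ^ 'n \<Rightarrow> real ^ 'n" where
  "fewnomial_system A c x = (\<chi> k. \<Sum>\<alpha>\<in>A k. c k \<alpha> * monomial_fun \<alpha> x)"

definition regular_zeros ::
    "(real ^ 'n \<Rightarrow> real ^ 'n) \<Rightarrow> (real ^ 'n) set \<Rightarrow> (real ^ 'n) set" where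
  "regular_zeros F S = {x \<in> S. F x = 0 \<and> det (jacobian F (at x)) \<noteq> 0}"

definition polytope_vertices :: "'a::real_vector set \<Rightarrow> 'a set" where
  "polytope_vertices P = {x. x extreme_point_of P}"

(* Cardinality in [0, \<infinity>]: unlike card, it is \<infinity> on infinite sets. *)
definition num_elements :: "'a set \<Rightarrow> ennreal" where
  "num_elements S = emeasure (count_space UNIV) S"

end

theory Submission
  imports Defs
begin

text \<open>
The bound comes from a Kac--Rice computation, done separately in each normal cone of the Minkowski
sum \<open>P = P\<^sub>1 + \<dots> + P\<^sub>n\<close>.

Write a vertex \<open>p\<close> of \<open>P\<close> as a sum of points \<open>a\<^sub>k\<close> of \<open>P\<^sub>k\<close>. Each \<open>a\<^sub>k\<close> is a vertex of \<open>P\<^sub>k\<close>,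
so it lies in \<open>A\<^sub>k\<close> and its coefficient has variance 1. On the chart of \<open>p\<close>, where \<open>x\<close> to the
power \<open>\<alpha> - a\<^sub>k\<close> is at most 1 for all \<open>k\<close> and all \<open>\<alpha>\<close> in \<open>A\<^sub>k\<close>, one divides the \<open>k\<close>-th component by
\<open>x\<close> to the power \<open>a\<^sub>k\<close>. Every point of the orthant lies in some chart, because the linear functional
with vector \<open>ln x\<close> attains its maximum over \<open>P\<close> at a vertex (\<open>Minkowski_sum_vertex_charts\<close>). It
remains to bound the expected number of zeros in one chart by \<open>4\<close> to the power \<open>-n\<close> times the
product of the \<open>t\<^sub>k - 1\<close>.

The number of regular zeros of \<open>F\<close> is at most the lower limit, as \<open>\<epsilon>\<close> tends to 0, of the integrals of
\<open>\<bar>det DF\<bar>\<close> times a product of centered Gaussian densities of standard deviation \<open>\<epsilon>\<close> evaluated at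
the components of \<open>F\<close> (\<open>count_regular_zeros_le_liminf\<close>). Taking expectations under the integral
and expanding the determinant multilinearly gives one term for each choice of exponents
\<open>b\<^sub>k \<noteq> a\<^sub>k\<close> in \<open>A\<^sub>k\<close>; there are exactly \<open>(t\<^sub>1 - 1) \<dots> (t\<^sub>n - 1)\<close> of them. By independence each term is
a determinant times a product over \<open>k\<close>. The \<open>k\<close>-th factor is an explicit Gaussian integral which
is at most \<open>u / (pi * (1 + u\<^sup>2))\<close>, where \<open>u \<le> 1\<close> is the standard deviation of the coefficient of
\<open>b\<^sub>k\<close> times \<open>x\<close> to the power \<open>b\<^sub>k - a\<^sub>k\<close> (\<open>expectation_normal_kernel_coefficient_le\<close>). This is where the
variances being at most 1 and the restriction to the chart enter.

Finally the quantities \<open>u\<close> for the different \<open>k\<close> serve as new coordinates on the chart, with values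
in the unit cube. After this substitution the term is at most the \<open>n\<close>-th power of the integral of
\<open>1 / (pi * (1 + u\<^sup>2))\<close> over \<open>[0, 1]\<close>, which is \<open>1 / 4\<close> (\<open>nn_integral_monomial_chart_le\<close>). The
charts are enlarged by a factor \<open>K > 1\<close> to make them open, and \<open>K\<close> tends to 1 at the end.
\<close>

section \<open>Change of variables for arbitrary finite index types\<close>

text \<open>A well-ordered finite type with as many elements as \<open>'n\<close>. Relabelling coordinates along a
bijection carries the change-of-variables theorem from well-ordered index types to arbitrary
finite ones.\<close>

typedef (overloaded) 'n idx = "{..<CARD('n::finite)}"
  by (rule exI[of _ 0]) simp

instantiation idx :: (finite) linorder
begin
definition less_eq_idx :: "'a idx \<Rightarrow> 'a idx \<Rightarrow> bool" where "less_eq_idx x y \<longleftrightarrow> Rep_idx x \<le> Rep_idx y"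
definition less_idx :: "'a idx \<Rightarrow> 'a idx \<Rightarrow> bool" where "less_idx x y \<longleftrightarrow> Rep_idx x < Rep_idx y"
instance
  by standard (auto simp: less_eq_idx_def less_idx_def Rep_idx_inject)
end

instance idx :: (finite) wellorder
proof
  fix P :: "'a idx \<Rightarrow> bool" and x
  assume step: "\<And>x. (\<And>y. y < x \<Longrightarrow> P y) \<Longrightarrow> P x"
  show "P x"
    by (induction x rule: measure_induct_rule[where f = Rep_idx])
      (rule step, simp add: less_idx_def)
qed

instance idx :: (finite) finite
proof
  have "range (Rep_idx :: 'a idx \<Rightarrow> nat) \<subseteq> {..<CARD('a)}"
    using Rep_idx by blast
  then show "finite (UNIV :: 'a idx set)"
    by (metis Rep_idx_inject finite_imageD finite_lessThan finite_subset inj_onI)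
qed

lemma card_idx: "CARD('n::finite idx) = CARD('n)"
proof -
  have "range (Rep_idx :: 'n idx \<Rightarrow> nat) = {..<CARD('n)}"
    using type_definition.Rep_range[OF type_definition_idx] .
  then show ?thesis
    by (metis Rep_idx_inject card_image card_lessThan inj_onI)
qed

text \<open>Relabelling rows and columns simultaneously conjugates each permutation of the Leibniz formula,
and conjugation preserves signs.\<close>

lemma det_reindex:
  fixes A :: "real ^ 'n ^ 'n" and b :: "'m::finite \<Rightarrow> 'n::finite"
  assumes b: "bij b"
  shows "det (\<chi> i j. A $ b i $ b j) = det A"
proof -
  let ?m = "map_permutation (UNIV :: 'm set) b"
  have inj: "inj b" and surj: "range b = UNIV"
    using b by (auto simp: bij_def)
  have bij: "bij_betw ?m {p. p permutes UNIV} {p. p permutes (UNIV :: 'n set)}"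
  proof (rule bij_betw_byWitness[where f' = "map_permutation (UNIV :: 'n set) (inv b)"])
    show "\<forall>p\<in>{p. p permutes UNIV}. map_permutation UNIV (inv b) (?m p) = p"
      using inj surj bij_imp_bij_inv[OF b]
      by (auto simp: fun_eq_iff map_permutation_def restrict_id_def surj_f_inv_f inv_inv_eq b bij_def)
    show "\<forall>p\<in>{p. p permutes UNIV}. ?m (map_permutation UNIV (inv b) p) = p"
      using inj surj bij_imp_bij_inv[OF b]
      by (auto simp: fun_eq_iff map_permutation_def restrict_id_def surj_f_inv_f inv_inv_eq b bij_def)
    show "?m ` {p. p permutes UNIV} \<subseteq> {p. p permutes UNIV}"
      using map_permutation_permutes[of b UNIV UNIV] b by (auto simp: bij_betw_def bij_def)
    show "map_permutation UNIV (inv b) ` {p. p permutes UNIV} \<subseteq> {p. p permutes UNIV}"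
      using map_permutation_permutes[of "inv b" UNIV UNIV] bij_imp_bij_inv[OF b]
      by (auto simp: bij_betw_def bij_def)
  qed
  have "det A = (\<Sum>p | p permutes (UNIV :: 'm set). of_int (sign (?m p)) * (\<Prod>i\<in>UNIV. A $ i $ ?m p i))"
    unfolding det_def by (rule sum.reindex_bij_betw[OF bij, symmetric])
  also have "\<dots> = (\<Sum>p | p permutes (UNIV :: 'm set). of_int (sign p) * (\<Prod>i\<in>UNIV. A $ b i $ b (p i)))"
  proof (rule sum.cong)
    fix p :: "'m \<Rightarrow> 'm" assume p: "p \<in> {p. p permutes UNIV}"
    have "(\<Prod>i\<in>UNIV. A $ i $ ?m p i) = (\<Prod>i\<in>UNIV. A $ b i $ ?m p (b i))"
      by (rule prod.reindex_bij_betw[OF b, symmetric])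
    also have "\<dots> = (\<Prod>i\<in>UNIV. A $ b i $ b (p i))"
      using inj surj by (intro prod.cong) (auto simp: map_permutation_def restrict_id_def)
    finally show "of_int (sign (?m p)) * (\<Prod>i\<in>UNIV. A $ i $ ?m p i) = of_int (sign p) * (\<Prod>i\<in>UNIV. A $ b i $ b (p i))"
      using p sign_map_permutation[of b UNIV p] inj by simp
  qed simp
  finally show ?thesis by (simp add: det_def)
qed

lemma Basis_vec_real: "Basis = range (\<lambda>i::'n::finite. axis i (1::real))"
  by (auto simp: Basis_vec_def)

lemma prod_Basis_vec: "(\<Prod>b\<in>Basis. h b) = (\<Prod>i\<in>UNIV. h (axis i (1::real)))"
  for h :: "real ^ 'n::finite \<Rightarrow> 'b::comm_monoid_mult"
  unfolding Basis_vec_real by (subst prod.reindex) (auto simp: inj_on_def axis_eq_axis)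

lemma distr_reindex_lborel:
  fixes b :: "'m::finite \<Rightarrow> 'n::finite"
  assumes b: "bij b"
  shows "distr lborel borel (\<lambda>x::real^'n. \<chi> i. x $ b i) = (lborel :: (real^'m) measure)"
proof (rule lborel_eqI[symmetric])
  have meas: "(\<lambda>x::real^'n. \<chi> i. x $ b i) \<in> borel_measurable borel"
    by (intro borel_measurable_continuous_onI continuous_intros)
  fix l u :: "real^'m"
  assume lu: "\<And>b. b \<in> Basis \<Longrightarrow> l \<bullet> b \<le> u \<bullet> b"
  let ?l = "\<chi> j. l $ inv b j" and ?u = "\<chi> j. u $ inv b j"
  have le: "l $ i \<le> u $ i" for i
    using lu[of "axis i 1"] by (simp add: inner_axis Basis_vec_real)
  have "(\<lambda>x::real^'n. \<chi> i. x $ b i) -` box l u = box ?l ?u"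
    using b by (auto simp: mem_box_cart bij_def surj_f_inv_f inv_f_f)
      (metis surj_f_inv_f inv_f_f)+
  then have "emeasure (distr lborel borel (\<lambda>x::real^'n. \<chi> i. x $ b i)) (box l u) = emeasure lborel (box ?l ?u)"
    using meas by (subst emeasure_distr) auto
  also have "\<dots> = (\<Prod>c\<in>Basis. (?u - ?l) \<bullet> c)"
    by (rule emeasure_lborel_box) (use le in \<open>auto simp: Basis_vec_real inner_axis\<close>)
  also have "\<dots> = ennreal (\<Prod>i\<in>UNIV. (u - l) $ inv b i)"
    by (simp add: prod_Basis_vec inner_axis)
  also have "\<dots> = ennreal (\<Prod>i\<in>UNIV. (u - l) $ i)"
    using prod.reindex_bij_betw[OF bij_imp_bij_inv[OF b], of "\<lambda>i. (u - l) $ i"] by simp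
  finally show "emeasure (distr lborel borel (\<lambda>x::real^'n. \<chi> i. x $ b i)) (box l u) = ennreal (\<Prod>b\<in>Basis. (u - l) \<bullet> b)"
    by (simp add: prod_Basis_vec inner_axis)
qed simp

text \<open>By invariance of domain the image \<open>g ` S\<close> is open, so the substitution rule for absolutely
integrable functions can be read as an identity of Borel integrals.\<close>

lemma nn_integral_change_of_variables_wellorder:
  fixes g :: "real^'n::{finite,wellorder} \<Rightarrow> real^'n::{finite,wellorder}" and f :: "real^'n::{finite,wellorder} \<Rightarrow> real"
  assumes S: "open S"
    and der: "\<And>x. x \<in> S \<Longrightarrow> (g has_derivative (*v) (J x)) (at x)"
    and inj: "inj_on g S"
    and f0: "\<And>y. 0 \<le> f y"
    and f: "integrable lborel f"
  shows "(\<integral>\<^sup>+x\<in>S. ennreal (\<bar>det (J x)\<bar> * f (g x)) \<partial>lborel) = (\<integral>\<^sup>+y\<in>g ` S. ennreal (f y) \<partial>lborel)"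
proof -
  let ?D = "\<lambda>x. \<bar>det (J x)\<bar> * f (g x)"
  have gS: "open (g ` S)"
    using S inj der
    by (intro invariance_of_domain) (auto intro!: continuous_at_imp_continuous_on has_derivative_continuous)
  have fi: "f absolutely_integrable_on (g ` S)"
    unfolding set_integrable_def using gS f
    by (intro integrable_mult_indicator integrable_completion[THEN iffD2]) (auto intro!: borel_measurable_integrable)
  \<comment> \<open>The substitution rule is about vector-valued integrands, hence the detour through \<open>real^1\<close>.\<close>
  have "(\<lambda>x. vec (f x) :: real^1) absolutely_integrable_on (g ` S)"
    using fi by (simp add: absolutely_integrable_on_1_iff)
  then have *: "(\<lambda>x. \<bar>det (matrix ((*v) (J x)))\<bar> *\<^sub>R (vec (f (g x)) :: real^1)) absolutely_integrable_on S
      \<and> integral S (\<lambda>x. \<bar>det (matrix ((*v) (J x)))\<bar> *\<^sub>R (vec (f (g x)) :: real^1)) = integral (g ` S) (\<lambda>x. vec (f x))"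
    using S der inj
    by (subst has_absolute_integral_change_of_variables) (auto intro: has_derivative_at_withinI)
  have eq: "(\<lambda>x. \<bar>det (matrix ((*v) (J x)))\<bar> *\<^sub>R (vec (f (g x)) :: real^1)) = (\<lambda>x. vec (?D x))"
    by (simp add: fun_eq_iff vec_eq_iff matrix_of_matrix_vector_mul)
  have Di: "?D absolutely_integrable_on S"
    using * unfolding eq by (simp add: absolutely_integrable_on_1_iff)
  have Deq: "integral S ?D = integral (g ` S) f"
    using * Di fi unfolding eq
    by (auto simp: integral_on_1_eq absolutely_integrable_on_def)
  have conv: "(\<integral>\<^sup>+x\<in>T. ennreal (h x) \<partial>lborel) = ennreal (integral T h)"
    if h: "h absolutely_integrable_on T" and h0: "\<And>x. 0 \<le> h x" for h :: "real^'n::{finite,wellorder} \<Rightarrow> real" and T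
  proof -
    have "(\<integral>\<^sup>+x\<in>T. ennreal (h x) \<partial>lborel) = (\<integral>\<^sup>+x. ennreal (indicat_real T x *\<^sub>R h x) \<partial>lebesgue)"
      unfolding nn_integral_completion by (intro nn_integral_cong) (auto simp: indicator_def)
    also have "\<dots> = ennreal (set_lebesgue_integral lebesgue T h)"
      unfolding set_lebesgue_integral_def
      using h h0 by (intro nn_integral_eq_integral) (auto simp: set_integrable_def)
    also have "\<dots> = ennreal (integral T h)"
      using set_lebesgue_integral_eq_integral(2)[OF h] by simp
    finally show ?thesis .
  qed
  show ?thesis
    using conv[OF Di] conv[OF fi] Deq f0 by simp
qed

text \<open>The map \<open>g\<close> is conjugated by the relabelling \<open>T\<close> of coordinates, which preserves Lebesgue measure
and, by \<open>det_reindex\<close>, the Jacobian determinant.\<close>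

lemma nn_integral_change_of_variables:
  fixes g :: "real^'n::finite \<Rightarrow> real^'n" and f :: "real^'n \<Rightarrow> real"
  assumes S: "open S"
    and der: "\<And>x. x \<in> S \<Longrightarrow> (g has_derivative (*v) (J x)) (at x)"
    and inj: "inj_on g S"
    and J: "J \<in> borel_measurable (restrict_space borel S)"
    and f0: "\<And>y. 0 \<le> f y"
    and f: "integrable lborel f"
  shows "(\<integral>\<^sup>+x\<in>S. ennreal (\<bar>det (J x)\<bar> * f (g x)) \<partial>lborel) = (\<integral>\<^sup>+y\<in>g ` S. ennreal (f y) \<partial>lborel)"
proof -
  obtain b :: "'n idx \<Rightarrow> 'n" where b: "bij b"
    using card_idx[where 'n='n] finite_same_card_bij[of "UNIV :: 'n idx set" "UNIV :: 'n set"] by auto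
  define T where "T x = (\<chi> i. x $ b i)" for x :: "real^'n"
  define R where "R x = (\<chi> i. x $ inv b i)" for x :: "real^'n idx"
  have RT [simp]: "R (T x) = x" for x
    using b by (simp add: R_def T_def vec_eq_iff bij_def surj_f_inv_f)
  have TR [simp]: "T (R x) = x" for x
    using b by (simp add: R_def T_def vec_eq_iff bij_def inv_f_f)
  have bT: "bounded_linear T"
    by (rule linear_conv_bounded_linear[THEN iffD1], rule linearI) (auto simp: T_def vec_eq_iff)
  have bR: "bounded_linear R"
    by (rule linear_conv_bounded_linear[THEN iffD1], rule linearI) (auto simp: R_def vec_eq_iff)
  have T_meas [measurable]: "T \<in> borel_measurable borel"
    using bT by (intro borel_measurable_continuous_onI) (simp add: linear_continuous_on)
  have R_meas [measurable]: "R \<in> borel_measurable borel"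
    using bR by (intro borel_measurable_continuous_onI) (simp add: linear_continuous_on)
  have distrT: "distr lborel borel T = lborel"
    using distr_reindex_lborel[OF b] by (simp add: T_def[abs_def])
  have distrR: "distr lborel borel R = lborel"
    using distr_reindex_lborel[OF bij_imp_bij_inv[OF b]] by (simp add: R_def[abs_def])
  define J' where "J' x = (\<chi> i j. J (R x) $ b i $ b j)" for x
  let ?S = "R -` S"
  have TS: "?S = T ` S"
    using RT TR by (metis (no_types, lifting) bij_betw_def equalityI image_subset_iff subsetI vimageE vimageI2 rev_image_eqI)
  have openS: "open ?S"
    using S bR by (intro open_vimage) (auto simp: linear_continuous_on)
  have g_img: "(\<lambda>x. T (g (R x))) ` ?S = R -` (g ` S)"
    unfolding TS image_image RT
    by (auto, metis RT TR image_eqI)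
  have J'v: "J' x *v h = T (J (R x) *v R h)" for x h
  proof -
    have "(\<Sum>j\<in>UNIV. J (R x) $ b i $ b j * h $ j) = (\<Sum>j\<in>UNIV. J (R x) $ b i $ j * h $ inv b j)" for i
      using sum.reindex_bij_betw[OF b, of "\<lambda>j. J (R x) $ b i $ j * h $ inv b j"] b
      by (simp add: bij_def inv_f_f)
    then show ?thesis
      by (simp add: J'_def T_def R_def matrix_vector_mult_def vec_eq_iff)
  qed
  have "(\<integral>\<^sup>+x\<in>?S. ennreal (\<bar>det (J' x)\<bar> * f (R (T (g (R x))))) \<partial>lborel)
      = (\<integral>\<^sup>+y\<in>(\<lambda>x. T (g (R x))) ` ?S. ennreal (f (R y)) \<partial>lborel)"
  proof (rule nn_integral_change_of_variables_wellorder[where f = "\<lambda>y. f (R y)"])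
    fix x assume x: "x \<in> ?S"
    show "((\<lambda>x. T (g (R x))) has_derivative (*v) (J' x)) (at x)"
      unfolding J'v
      using x by (intro bounded_linear.has_derivative[OF bT] 
          has_derivative_compose[OF bounded_linear_imp_has_derivative[OF bR], of g]) (auto intro: der)
  next
    have "inj T" "inj R" by (metis RT injI, metis TR injI)
    then show "inj_on (\<lambda>x. T (g (R x))) ?S"
      using inj by (auto simp: inj_on_def)
    have "integrable (distr lborel borel R) f"
      using f distrR by simp
    then show "integrable lborel (\<lambda>y. f (R y))"
      by (subst (asm) integrable_distr_eq) (use f in auto)
  qed (use f0 openS in auto)
  also have "(\<integral>\<^sup>+x\<in>?S. ennreal (\<bar>det (J' x)\<bar> * f (R (T (g (R x))))) \<partial>lborel)
     = (\<integral>\<^sup>+x\<in>S. ennreal (\<bar>det (J x)\<bar> * f (g x)) \<partial>distr lborel borel R)"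
  proof -
    have "continuous_on S g" 
      using der by (auto intro!: continuous_at_imp_continuous_on has_derivative_continuous)
    then have gm: "g \<in> borel_measurable (restrict_space borel S)"
      by (rule borel_measurable_continuous_on_restrict)
    have fm: "f \<in> borel_measurable borel" using f by auto
    have "(\<lambda>x. f (g x)) \<in> borel_measurable (restrict_space borel S)"
      using measurable_comp[OF gm fm] by (simp add: comp_def)
    moreover have "(\<lambda>x. \<bar>det (J x)\<bar>) \<in> borel_measurable (restrict_space borel S)"
    proof -
      have "(\<lambda>x. J x $ i $ j) \<in> borel_measurable (restrict_space borel S)" for i j
        by (rule measurable_compose[OF J, of "\<lambda>A. A $ i $ j"])
          (intro borel_measurable_continuous_onI continuous_intros)
      then show ?thesis
        unfolding det_def by measurable
    qed
    ultimately have "(\<lambda>x. ennreal (\<bar>det (J x)\<bar> * f (g x))) \<in> borel_measurable (restrict_space borel S)"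
      by measurable
    then have "(\<lambda>x. ennreal (\<bar>det (J x)\<bar> * f (g x)) * indicator S x) \<in> borel_measurable borel"
      using S by (subst (asm) borel_measurable_restrict_space_iff_ennreal) auto
    moreover have "det (J' x) = det (J (R x))" for x
      unfolding J'_def by (rule det_reindex[OF b])
    ultimately show ?thesis
      by (subst nn_integral_distr) (auto simp: indicator_def)
  qed
  also have "(\<integral>\<^sup>+y\<in>(\<lambda>x. T (g (R x))) ` ?S. ennreal (f (R y)) \<partial>lborel) = (\<integral>\<^sup>+y\<in>g ` S. ennreal (f y) \<partial>distr lborel borel R)"
  proof -
    have "open (g ` S)"
      using S inj der
      by (intro invariance_of_domain) (auto intro!: continuous_at_imp_continuous_on has_derivative_continuous)
    then show ?thesis
      unfolding g_img using f
      by (subst nn_integral_distr) (auto intro!: nn_integral_cong split: split_indicator)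
  qed
  finally show ?thesis unfolding distrR .
qed

section \<open>Counting regular zeros by concentrating Gaussian kernels\<close>

lemma nn_integral_prod_components:
  fixes h :: "'n::finite \<Rightarrow> real \<Rightarrow> ennreal"
  assumes [measurable]: "\<And>i. h i \<in> borel_measurable borel"
  shows "(\<integral>\<^sup>+x. (\<Prod>i\<in>UNIV. h i (x $ i)) \<partial>(lborel :: (real^'n) measure)) = (\<Prod>i\<in>UNIV. \<integral>\<^sup>+t. h i t \<partial>lborel)"
proof -
  define idx where "idx b = (SOME i. b = axis i (1::real))" for b :: "real^'n"
  have idx [simp]: "idx (axis i 1) = i" for i
    unfolding idx_def by (rule some_equality) (auto simp: axis_eq_axis)
  have "(\<integral>\<^sup>+x. (\<Prod>b\<in>Basis. h (idx b) (x \<bullet> b)) \<partial>(lborel :: (real^'n) measure)) = (\<Prod>b\<in>Basis. \<integral>\<^sup>+t. h (idx b) t \<partial>lborel)"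
    by (rule nn_integral_lborel_prod) auto
  then show ?thesis
    by (simp add: prod_Basis_vec inner_axis)
qed

lemma nn_integral_normal_density:
  "0 < \<sigma> \<Longrightarrow> (\<integral>\<^sup>+x. ennreal (normal_density \<mu> \<sigma> x) \<partial>lborel) = 1"
  by (subst nn_integral_eq_integral) auto

lemma normal_density_rescale:
  "0 < \<sigma> \<Longrightarrow> normal_density 0 \<sigma> (\<sigma> * x) * \<sigma> = std_normal_density x"
  by (simp add: normal_density_def real_sqrt_mult power_mult_distrib)

text \<open>Rescaling by the standard deviation turns the fixed interval into intervals that exhaust the line.\<close>

lemma normal_density_concentrates:
  assumes s: "0 < s"
  shows "(\<lambda>j. \<integral>\<^sup>+t\<in>{-s<..<s}. ennreal (normal_density 0 (1 / Suc j) t) \<partial>lborel) \<longlonglongrightarrow> 1"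
proof -
  let ?g = "\<lambda>j x. ennreal (std_normal_density x) * indicator {- s * Suc j<..<s * Suc j} x"
  have "(\<integral>\<^sup>+t\<in>{-s<..<s}. ennreal (normal_density 0 (1 / Suc j) t) \<partial>lborel) = (\<integral>\<^sup>+x. ?g j x \<partial>lborel)" for j
  proof -
    have "(\<integral>\<^sup>+t\<in>{-s<..<s}. ennreal (normal_density 0 (1 / Suc j) t) \<partial>lborel)
        = ennreal \<bar>1 / Suc j\<bar> * (\<integral>\<^sup>+x. ennreal (normal_density 0 (1 / Suc j) (0 + (1 / Suc j) * x))
             * indicator {-s<..<s} (0 + (1 / Suc j) * x) \<partial>lborel)"
      by (rule nn_integral_real_affine) auto
    also have "\<dots> = (\<integral>\<^sup>+x. ennreal \<bar>1 / Suc j\<bar> * (ennreal (normal_density 0 (1 / Suc j) (0 + (1 / Suc j) * x))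
             * indicator {-s<..<s} (0 + (1 / Suc j) * x)) \<partial>lborel)"
      by (rule nn_integral_cmult[symmetric]) auto
    also have "\<dots> = (\<integral>\<^sup>+x. ?g j x \<partial>lborel)"
    proof (rule nn_integral_cong)
      fix x :: real
      have "ennreal \<bar>1 / Suc j\<bar> * ennreal (normal_density 0 (1 / Suc j) (0 + (1 / Suc j) * x)) = ennreal (std_normal_density x)"
        using normal_density_rescale[of "1 / Suc j" x] by (subst ennreal_mult'[symmetric]) (auto simp: mult.commute)
      moreover have "indicator {-s<..<s} (0 + (1 / Suc j) * x) = (indicator {- s * Suc j<..<s * Suc j} x :: ennreal)"
        by (auto simp: indicator_def field_simps)
      ultimately show "ennreal \<bar>1 / Suc j\<bar> * (ennreal (normal_density 0 (1 / Suc j) (0 + (1 / Suc j) * x))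
             * indicator {-s<..<s} (0 + (1 / Suc j) * x)) = ?g j x"
        by (simp add: mult.assoc[symmetric])
    qed
    finally show ?thesis .
  qed
  moreover have "(\<lambda>j. \<integral>\<^sup>+x. ?g j x \<partial>lborel) \<longlonglongrightarrow> (\<integral>\<^sup>+x. ennreal (std_normal_density x) \<partial>lborel)"
  proof (rule nn_integral_LIMSEQ)
    show "incseq ?g"
    proof (rule incseq_SucI, rule le_funI)
      fix j x
      have "s * Suc j \<le> s * Suc (Suc j)" using s by simp
      then show "?g j x \<le> ?g (Suc j) x" by (auto simp: indicator_def)
    qed
    show "(\<lambda>j. ?g j x) \<longlonglongrightarrow> ennreal (std_normal_density x)" for x
    proof (rule tendsto_eventually)
      obtain N where N: "\<bar>x\<bar> / s < real N" using reals_Archimedean2 by blast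
      have "\<bar>x\<bar> < s * Suc j" if "N \<le> j" for j
      proof -
        have "\<bar>x\<bar> < s * N" using N s by (simp add: field_simps)
        also have "\<dots> \<le> s * Suc j" using that s by simp
        finally show ?thesis .
      qed
      then have "x \<in> {- s * Suc j<..<s * Suc j}" if "N \<le> j" for j
        using that abs_less_iff[of x "s * Suc j"] by auto
      then show "\<forall>\<^sub>F j in sequentially. ?g j x = ennreal (std_normal_density x)"
        unfolding eventually_sequentially by (intro exI[of _ N]) simp
    qed
  qed auto
  ultimately show ?thesis by (simp add: nn_integral_normal_density)
qed

lemma normal_density_prod_concentrates:
  assumes s: "0 < s"
  shows "(\<lambda>j. \<integral>\<^sup>+y\<in>{y. \<forall>k. \<bar>y $ k\<bar> < s}. ennreal (\<Prod>k\<in>UNIV. normal_density 0 (1 / Suc j) (y $ k))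
      \<partial>(lborel :: (real^'n::finite) measure)) \<longlonglongrightarrow> 1"
proof -
  have eq: "(\<integral>\<^sup>+y\<in>{y. \<forall>k. \<bar>y $ k\<bar> < s}. ennreal (\<Prod>k\<in>UNIV. normal_density 0 (1 / Suc j) (y $ k))
      \<partial>(lborel :: (real^'n::finite) measure))
      = (\<Prod>k\<in>(UNIV::'n set). \<integral>\<^sup>+t\<in>{-s<..<s}. ennreal (normal_density 0 (1 / Suc j) t) \<partial>lborel)" for j
  proof (subst nn_integral_prod_components[symmetric])
    have "indicator {y::real^'n. \<forall>k. \<bar>y $ k\<bar> < s} y = (\<Prod>k\<in>UNIV. indicator {-s<..<s} (y $ k) :: ennreal)" for y
    proof (cases "\<forall>k. \<bar>y $ k\<bar> < s")
      case True
      then have "y $ k \<in> {-s<..<s}" for k using abs_less_iff[of "y $ k" s] by auto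
      then show ?thesis using True by simp
    next
      case False
      then obtain k where "\<not> \<bar>y $ k\<bar> < s" by blast
      then have "y $ k \<notin> {-s<..<s}" by auto
      then have "indicator {-s<..<s} (y $ k) = (0 :: ennreal)"
        by (rule indicator_simps)
      then have "(\<Prod>k\<in>UNIV. indicator {-s<..<s} (y $ k) :: ennreal) = 0"
        by (intro prod_zero finite bexI[of _ k]) auto
      then show ?thesis using False by simp
    qed
    then show "(\<integral>\<^sup>+y\<in>{y. \<forall>k. \<bar>y $ k\<bar> < s}. ennreal (\<Prod>k\<in>UNIV. normal_density 0 (1 / Suc j) (y $ k))
      \<partial>(lborel :: (real^'n) measure)) = (\<integral>\<^sup>+y. (\<Prod>k\<in>UNIV. ennreal (normal_density 0 (1 / Suc j) (y $ k)) * indicator {-s<..<s} (y $ k)) \<partial>(lborel :: (real^'n) measure))"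
      by (simp add: prod.distrib prod_ennreal)
  qed auto
  have "(\<lambda>j. (\<integral>\<^sup>+t\<in>{-s<..<s}. ennreal (normal_density 0 (1 / Suc j) t) \<partial>lborel) ^ n) \<longlonglongrightarrow> 1" for n
  proof (induction n)
    case (Suc n)
    show ?case
      using tendsto_mult_ennreal[OF normal_density_concentrates[OF s] Suc] by simp
  qed simp
  then show ?thesis unfolding eq prod_constant .
qed

lemma integrable_normal_density_prod:
  assumes "0 < \<sigma>"
  shows "integrable (lborel :: (real^'n::finite) measure) (\<lambda>y. \<Prod>k\<in>UNIV. normal_density 0 \<sigma> (y $ k))"
proof (rule integrableI_nonneg)
  have "(\<integral>\<^sup>+y. ennreal (\<Prod>k\<in>UNIV. normal_density 0 \<sigma> (y $ k)) \<partial>(lborel :: (real^'n) measure)) = 1"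
    using nn_integral_prod_components[of "\<lambda>(k::'n) t. ennreal (normal_density 0 \<sigma> t)"] assms
    by (simp add: prod_ennreal nn_integral_normal_density)
  then show "(\<integral>\<^sup>+y. ennreal (\<Prod>k\<in>UNIV. normal_density 0 \<sigma> (y $ k)) \<partial>(lborel :: (real^'n) measure)) < \<infinity>"
    by simp
qed (auto intro!: prod_nonneg)

text \<open>The Jacobian depends continuously on the point, so near \<open>a\<close> it stays close to \<open>J a\<close> in operator
norm; the invertibility of \<open>J a\<close> then forces injectivity on a small ball.\<close>

lemma locally_injective_at_regular_point:
  fixes F :: "real^'n::finite \<Rightarrow> real^'n"
  assumes U: "open U" and a: "a \<in> U"
    and der: "\<And>x. x \<in> U \<Longrightarrow> (F has_derivative (*v) (J x)) (at x)"
    and cont: "continuous_on U J"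
    and reg: "det (J a) \<noteq> 0"
  obtains r where "0 < r" "ball a r \<subseteq> U" "inj_on F (ball a r)"
proof -
  obtain B where B: "B ** J a = mat 1"
    using reg by (meson invertible_det_nz invertible_def)
  show ?thesis
  proof (rule has_derivative_locally_injective[OF a U, of "(*v) B" "\<lambda>x. (*v) (J x)" F])
    show "(*v) B \<circ> (*v) (J a) = id"
      by (simp add: fun_eq_iff matrix_vector_mul_assoc B)
    fix e :: real assume e: "0 < e"
    \<comment> \<open>An \<open>n\<times>n\<close> matrix with entries at most \<open>c\<close> has operator norm at most \<open>n * n * c\<close>; the summand 1 makes the bound strict.\<close>
    define c where "c = e / (real CARD('n) * real CARD('n) + 1)"
    have c: "0 < c" using e by (simp add: c_def add_nonneg_pos)
    obtain d0 where d0: "0 < d0" "\<And>x. x \<in> U \<Longrightarrow> dist x a < d0 \<Longrightarrow> dist (J x) (J a) < c"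
      using cont a c unfolding continuous_on_iff by metis
    obtain d1 where d1: "0 < d1" "ball a d1 \<subseteq> U" using U a open_contains_ball by blast
    show "\<exists>d>0. \<forall>x. dist a x < d \<longrightarrow> onorm (\<lambda>v. J x *v v - J a *v v) < e"
    proof (intro exI[of _ "min d0 d1"] conjI allI impI)
      fix x assume x: "dist a x < min d0 d1"
      then have "x \<in> U" using d1(2) by auto
      then have "norm (J x - J a) < c" using d0(2)[of x] x by (simp add: dist_commute dist_norm norm_minus_commute)
      then have "\<bar>(J x - J a) $ i $ j\<bar> \<le> c" for i j
        using component_le_norm_cart[of "(J x - J a) $ i" j] Finite_Cartesian_Product.norm_nth_le[of "J x - J a" i]
        by linarith
      then have "onorm ((*v) (J x - J a)) \<le> real CARD('n) * real CARD('n) * c"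
        by (rule onorm_le_matrix_component)
      also have "\<dots> < e"
        using e by (simp add: c_def field_simps add_nonneg_pos)
      moreover have "(\<lambda>v. J x *v v - J a *v v) = (*v) (J x - J a)"
        by (simp add: fun_eq_iff matrix_vector_mult_diff_rdistrib)
      ultimately show "onorm (\<lambda>v. J x *v v - J a *v v) < e"
        by simp
    qed (use d0 d1 in auto)
  qed (use der that in auto)
qed

lemma emeasure_count_space_le:
  assumes "\<And>Y. finite Y \<Longrightarrow> Y \<subseteq> Z \<Longrightarrow> ennreal (real (card Y)) \<le> c"
  shows "emeasure (count_space UNIV) Z \<le> c"
proof (cases "finite Z")
  case True
  then show ?thesis using assms[of Z] by (simp add: ennreal_of_nat_eq_real_of_nat)
next
  case False
  have "of_nat n \<le> c" for n
    using infinite_arbitrarily_large[OF False, of n] assms by (auto simp: ennreal_of_nat_eq_real_of_nat)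
  then have "c = \<infinity>"
    using ennreal_Ex_less_of_nat[of c] by (metis infinity_ennreal_def leD top.not_eq_extremum)
  then show ?thesis by simp
qed

text \<open>An inequality version of Kac's counting formula. Around each regular zero the map \<open>F\<close> is injective
with open image, and substitution turns the integral over a small ball into the mass that a
concentrating Gaussian gives to a neighbourhood of 0, which tends to 1. The gain is that the
right-hand side is an integral, to which Fatou's lemma and Tonelli's theorem apply.\<close>

lemma count_regular_zeros_le_liminf:
  fixes F :: "real^'n::finite \<Rightarrow> real^'n"
  assumes U: "open U"
    and der: "\<And>x. x \<in> U \<Longrightarrow> (F has_derivative (*v) (J x)) (at x)"
    and cont: "continuous_on U J"
  shows "emeasure (count_space UNIV) {x \<in> U. F x = 0 \<and> det (J x) \<noteq> 0}
     \<le> liminf (\<lambda>j. \<integral>\<^sup>+x\<in>U. ennreal (\<bar>det (J x)\<bar> * (\<Prod>k\<in>UNIV. normal_density 0 (1 / Suc j) (F x $ k))) \<partial>lborel)"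
    (is "_ \<le> liminf (\<lambda>j. \<integral>\<^sup>+x\<in>U. ?h j x \<partial>lborel)")
proof (rule emeasure_count_space_le)
  fix Y assume fin: "finite Y" and Y: "Y \<subseteq> {x \<in> U. F x = 0 \<and> det (J x) \<noteq> 0}"
  have "\<forall>p\<in>Y. \<exists>r>0. ball p r \<subseteq> U \<and> inj_on F (ball p r)"
  proof
    fix p assume "p \<in> Y"
    then show "\<exists>r>0. ball p r \<subseteq> U \<and> inj_on F (ball p r)"
      using Y locally_injective_at_regular_point[OF U _ der cont, of p] by blast
  qed
  then obtain r where r: "\<And>p. p \<in> Y \<Longrightarrow> 0 < r p" "\<And>p. p \<in> Y \<Longrightarrow> ball p (r p) \<subseteq> U" "\<And>p. p \<in> Y \<Longrightarrow> inj_on F (ball p (r p))"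
    by metis
  have "\<forall>p. \<exists>d>0. \<forall>q\<in>Y. q \<noteq> p \<longrightarrow> d \<le> dist p q"
    using finite_set_avoid[OF fin] by blast
  then obtain d where d: "\<And>p. 0 < d p" "\<And>p q. q \<in> Y \<Longrightarrow> q \<noteq> p \<Longrightarrow> d p \<le> dist p q"
    by metis
  \<comment> \<open>Radii of at most half the distance to the nearest other zero make the balls disjoint.\<close>
  define B where "B p = ball p (min (r p) (d p / 2))" for p
  have disj: "disjoint_family_on B Y"
    unfolding disjoint_family_on_def
  proof (intro ballI impI, rule ccontr)
    fix p q assume pq: "p \<in> Y" "q \<in> Y" "p \<noteq> q" and "B p \<inter> B q \<noteq> {}"
    then obtain x where "dist p x < d p / 2" "dist q x < d q / 2" by (auto simp: B_def)
    then have "dist p q < d p / 2 + d q / 2"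
      using dist_triangle2[of p q x] by linarith
    moreover have "d p \<le> dist p q" "d q \<le> dist p q"
      using d(2)[of q p] d(2)[of p q] pq by (auto simp: dist_commute)
    ultimately show False by simp
  qed
  have BU: "B p \<subseteq> U" and openB: "open (B p)" and pB: "p \<in> B p" and injB: "inj_on F (B p)" if "p \<in> Y" for p
    using r[OF that] d(1)[of p] by (auto simp: B_def intro: inj_on_subset)
  have contF: "continuous_on U F"
    using der by (auto intro!: continuous_at_imp_continuous_on has_derivative_continuous)
  have derB: "(F has_derivative (*v) (J x)) (at x)" if "p \<in> Y" "x \<in> B p" for p x
    using der BU that by blast
  have "\<forall>p\<in>Y. \<exists>s>0. {y. \<forall>k. \<bar>y $ k\<bar> < s} \<subseteq> F ` B p"
  proof
    fix p assume p: "p \<in> Y"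
    have "open (F ` B p)"
      using contF BU[OF p] openB[OF p] injB[OF p] by (intro invariance_of_domain) (auto intro: continuous_on_subset)
    moreover have "0 \<in> F ` B p" using Y p pB[OF p] by (auto intro!: image_eqI[of _ _ p])
    ultimately obtain e where e: "0 < e" "ball 0 e \<subseteq> F ` B p" using open_contains_ball by blast
    \<comment> \<open>The Euclidean norm is at most the sum of the absolute coordinates.\<close>
    let ?s = "e / CARD('n)"
    have "{y. \<forall>k. \<bar>y $ k\<bar> < ?s} \<subseteq> ball (0::real^'n) e"
    proof
      fix y :: "real^'n" assume "y \<in> {y. \<forall>k. \<bar>y $ k\<bar> < ?s}"
      then have "(\<Sum>k\<in>UNIV. \<bar>y $ k\<bar>) < (\<Sum>k\<in>(UNIV::'n set). ?s)"
        by (intro sum_strict_mono) auto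
      then show "y \<in> ball 0 e"
        using norm_le_l1_cart[of y] by simp
    qed
    then show "\<exists>s>0. {y. \<forall>k. \<bar>y $ k\<bar> < s} \<subseteq> F ` B p"
      using e by (intro exI[of _ ?s]) auto
  qed
  then obtain s where s: "\<And>p. p \<in> Y \<Longrightarrow> 0 < s p" "\<And>p. p \<in> Y \<Longrightarrow> {y. \<forall>k. \<bar>y $ k\<bar> < s p} \<subseteq> F ` B p"
    by metis
  let ?c = "\<lambda>p j. \<integral>\<^sup>+y\<in>{y. \<forall>k. \<bar>y $ k\<bar> < s p}. ennreal (\<Prod>k\<in>UNIV. normal_density 0 (1 / Suc j) (y $ k)) \<partial>(lborel :: (real^'n) measure)"
  have mJ: "J \<in> borel_measurable (restrict_space borel S)" if "S \<subseteq> U" for S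
    using cont that by (intro borel_measurable_continuous_on_restrict) (rule continuous_on_subset)
  have h_meas: "(\<lambda>x. ?h j x * indicator S x) \<in> borel_measurable borel" if S: "S \<subseteq> U" "open S" for S j
  proof -
    have "(\<lambda>x. J x $ i $ k) \<in> borel_measurable (restrict_space borel S)" for i k
      by (rule measurable_compose[OF mJ[OF S(1)], of "\<lambda>A. A $ i $ k"])
        (intro borel_measurable_continuous_onI continuous_intros)
    then have "(\<lambda>x. det (J x)) \<in> borel_measurable (restrict_space borel S)"
      unfolding det_def by measurable
    moreover have "(\<lambda>x. F x $ k) \<in> borel_measurable (restrict_space borel S)" for k
      using contF S by (intro borel_measurable_continuous_on_restrict continuous_intros) (auto intro: continuous_on_subset)
    ultimately have "?h j \<in> borel_measurable (restrict_space borel S)"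
      by measurable
    then show ?thesis
      using S by (subst (asm) borel_measurable_restrict_space_iff_ennreal) auto
  qed
  have le: "(\<Sum>p\<in>Y. ?c p j) \<le> (\<integral>\<^sup>+x\<in>U. ?h j x \<partial>lborel)" for j
  proof -
    have "(\<Sum>p\<in>Y. ?c p j) \<le> (\<Sum>p\<in>Y. \<integral>\<^sup>+x\<in>B p. ?h j x \<partial>lborel)"
    proof (rule sum_mono)
      fix p assume p: "p \<in> Y"
      have "?c p j \<le> (\<integral>\<^sup>+y\<in>F ` B p. ennreal (\<Prod>k\<in>UNIV. normal_density 0 (1 / Suc j) (y $ k)) \<partial>lborel)"
        using s(2)[OF p] by (intro nn_integral_mono) (auto split: split_indicator)
      also have "\<dots> = (\<integral>\<^sup>+x\<in>B p. ?h j x \<partial>lborel)"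
        using p by (intro nn_integral_change_of_variables[symmetric] openB injB derB mJ BU
            integrable_normal_density_prod prod_nonneg) auto
      finally show "?c p j \<le> (\<integral>\<^sup>+x\<in>B p. ?h j x \<partial>lborel)" .
    qed
    also have "\<dots> = (\<integral>\<^sup>+x. (\<Sum>p\<in>Y. ?h j x * indicator (B p) x) \<partial>lborel)"
      using h_meas[OF BU openB] by (intro nn_integral_sum[symmetric]) auto
    also have "\<dots> \<le> (\<integral>\<^sup>+x\<in>U. ?h j x \<partial>lborel)"
    proof (rule nn_integral_mono)
      fix x
      have "(\<Sum>p\<in>Y. indicator (B p) x) = (indicator (\<Union>p\<in>Y. B p) x :: ennreal)"
        by (rule indicator_UN_disjoint[symmetric, OF fin disj])
      also have "\<dots> \<le> indicator U x" using BU by (auto simp: indicator_def)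
      finally show "(\<Sum>p\<in>Y. ?h j x * indicator (B p) x) \<le> ?h j x * indicator U x"
        by (simp add: sum_distrib_left[symmetric] mult_left_mono)
    qed
    finally show ?thesis .
  qed
  have "(\<lambda>j. \<Sum>p\<in>Y. ?c p j) \<longlonglongrightarrow> (\<Sum>p\<in>Y. 1)"
    by (intro tendsto_sum normal_density_prod_concentrates s)
  then have "liminf (\<lambda>j. \<Sum>p\<in>Y. ?c p j) = of_nat (card Y)"
    by (simp add: lim_imp_Liminf)
  moreover have "liminf (\<lambda>j. \<Sum>p\<in>Y. ?c p j) \<le> liminf (\<lambda>j. \<integral>\<^sup>+x\<in>U. ?h j x \<partial>lborel)"
    by (intro Liminf_mono always_eventually allI le)
  ultimately show "ennreal (real (card Y)) \<le> liminf (\<lambda>j. \<integral>\<^sup>+x\<in>U. ?h j x \<partial>lborel)"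
    by (simp add: ennreal_of_nat_eq_real_of_nat)
qed

section \<open>Expectations of Gaussian kernels\<close>

lemma nn_integral_abs_exp_square:
  fixes q :: real
  assumes q: "0 < q"
  shows "(\<integral>\<^sup>+x. ennreal (\<bar>x\<bar> * exp (- (q * x\<^sup>2 / 2))) \<partial>lborel) = ennreal (2 / q)"
proof -
  let ?f = "\<lambda>x::real. \<bar>x\<bar> * exp (- (q * x\<^sup>2 / 2))"
  have "(\<integral>\<^sup>+x. ennreal (x * exp (- (q * x\<^sup>2 / 2))) * indicator {0..} x \<partial>lborel)
      = ennreal (0 - (- exp (- (q * 0\<^sup>2 / 2)) / q))"
  proof (rule nn_integral_FTC_atLeast)
    show "((\<lambda>x. - exp (- (q * x\<^sup>2 / 2)) / q) has_real_derivative x * exp (- (q * x\<^sup>2 / 2))) (at x)" for x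
      using q by (auto intro!: derivative_eq_intros)
    have "filterlim (\<lambda>x::real. q / 2 * x\<^sup>2) at_top at_top"
      using q by (intro filterlim_tendsto_pos_mult_at_top[OF tendsto_const] filterlim_pow_at_top filterlim_ident) auto
    then have "filterlim (\<lambda>x::real. - (q * x\<^sup>2 / 2)) at_bot at_top"
      by (subst filterlim_uminus_at_top[symmetric]) simp
    from filterlim_compose[OF exp_at_bot this]
    have "((\<lambda>x. - exp (- (q * x\<^sup>2 / 2)) / q) \<longlongrightarrow> - 0 / q) at_top"
      using q by (intro tendsto_divide tendsto_minus tendsto_const) auto
    then show "((\<lambda>x. - exp (- (q * x\<^sup>2 / 2)) / q) \<longlongrightarrow> 0) at_top" by simp
  qed auto
  moreover have "(\<integral>\<^sup>+x. ennreal (indicat_real {0..} x *\<^sub>R ?f x) \<partial>lborel)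
      = (\<integral>\<^sup>+x. ennreal (x * exp (- (q * x\<^sup>2 / 2))) * indicator {0..} x \<partial>lborel)"
    by (intro nn_integral_cong) (auto simp: indicator_def)
  ultimately have "(\<integral>\<^sup>+x. ennreal (indicat_real {0..} x *\<^sub>R ?f x) \<partial>lborel) = ennreal (1 / q)"
    by simp
  then have "has_bochner_integral lborel (\<lambda>x. indicat_real {0..} x *\<^sub>R ?f x) (1 / q)"
    using q by (intro has_bochner_integral_nn_integral) auto
  from has_bochner_integral_even_function[OF this]
  have "has_bochner_integral lborel ?f (2 * (1 / q))"
    by simp
  then show ?thesis
    by (subst nn_integral_eq_integral) (auto simp: has_bochner_integral_iff)
qed

text \<open>The product of the two densities is a multiple of \<open>exp (- q * x\<^sup>2 / 2)\<close>, whose inverse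
variance \<open>q\<close> is the sum of those of the factors.\<close>

lemma nn_integral_abs_normal_densities:
  fixes m :: real
  assumes \<sigma>: "0 < \<sigma>" and \<rho>: "0 < \<rho>"
  shows "(\<integral>\<^sup>+x. ennreal (normal_density 0 \<sigma> x * (normal_density 0 \<rho> (m * x) * \<bar>x\<bar>)) \<partial>lborel)
      = ennreal (\<sigma> * \<rho> / (pi * (\<rho>\<^sup>2 + (\<sigma> * m)\<^sup>2)))"
proof -
  define q where "q = 1 / \<sigma>\<^sup>2 + m\<^sup>2 / \<rho>\<^sup>2"
  have q: "0 < q" using \<sigma> by (simp add: q_def add_pos_nonneg)
  have "normal_density 0 \<sigma> x * (normal_density 0 \<rho> (m * x) * \<bar>x\<bar>)
      = 1 / (2 * pi * \<sigma> * \<rho>) * (\<bar>x\<bar> * exp (- (q * x\<^sup>2 / 2)))" for x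
  proof -
    have "exp (- (x\<^sup>2 / (2 * \<sigma>\<^sup>2))) * exp (- ((m * x)\<^sup>2 / (2 * \<rho>\<^sup>2))) = exp (- (q * x\<^sup>2 / 2))"
      unfolding exp_add[symmetric]
      by (rule arg_cong[of _ _ exp]) (simp add: q_def field_simps power_mult_distrib)
    moreover have "sqrt (2 * pi * \<sigma>\<^sup>2) * sqrt (2 * pi * \<rho>\<^sup>2) = 2 * pi * \<sigma> * \<rho>"
    proof -
      have "sqrt (2 * pi * s\<^sup>2) = sqrt (2 * pi) * s" if "0 < s" for s
        using that real_sqrt_mult[of "2 * pi" "s\<^sup>2"] by simp
      moreover have "sqrt (2 * pi) * sqrt (2 * pi) = 2 * pi"
        by (rule real_sqrt_mult_self[THEN trans]) simp
      ultimately show ?thesis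
        using \<sigma> \<rho> by (metis (no_types, lifting) mult.assoc mult.left_commute)
    qed
    ultimately show ?thesis
      by (simp add: normal_density_def field_simps)
  qed
  moreover have "ennreal (1 / (2 * pi * \<sigma> * \<rho>) * y) = ennreal (1 / (2 * pi * \<sigma> * \<rho>)) * ennreal y" for y
    using \<sigma> \<rho> by (intro ennreal_mult') simp
  ultimately have "(\<integral>\<^sup>+x. ennreal (normal_density 0 \<sigma> x * (normal_density 0 \<rho> (m * x) * \<bar>x\<bar>)) \<partial>lborel)
     = (\<integral>\<^sup>+x. ennreal (1 / (2 * pi * \<sigma> * \<rho>)) * ennreal (\<bar>x\<bar> * exp (- (q * x\<^sup>2 / 2))) \<partial>lborel)"
    by (simp only:)
  also have "\<dots> = ennreal (1 / (2 * pi * \<sigma> * \<rho>)) * ennreal (2 / q)"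
    by (subst nn_integral_cmult) (auto simp: nn_integral_abs_exp_square[OF q])
  also have "\<dots> = ennreal (1 / (2 * pi * \<sigma> * \<rho>) * (2 / q))"
    using \<sigma> \<rho> q by (intro ennreal_mult[symmetric]) auto
  also have "1 / (2 * pi * \<sigma> * \<rho>) * (2 / q) = \<sigma> * \<rho> / (pi * (\<rho>\<^sup>2 + (\<sigma> * m)\<^sup>2))"
  proof -
    have "1 / (2 * pi * \<sigma> * \<rho>) * (2 / (N / (\<sigma>\<^sup>2 * \<rho>\<^sup>2))) = \<sigma> * \<rho> / (pi * N)" for N
      using \<sigma> \<rho> by (cases "N = 0") (simp_all add: field_simps power2_eq_square)
    moreover have "q = (\<rho>\<^sup>2 + (\<sigma> * m)\<^sup>2) / (\<sigma>\<^sup>2 * \<rho>\<^sup>2)"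
      using \<sigma> \<rho> by (simp add: q_def field_simps power_mult_distrib)
    ultimately show ?thesis by simp
  qed
  finally show ?thesis .
qed

text \<open>Integrating over \<open>T\<close> first convolves the kernel with the law of \<open>T\<close>, which is again a centered
Gaussian kernel, now of variance \<open>\<epsilon>\<^sup>2 + \<tau>\<^sup>2\<close>. What remains is a one-dimensional first
absolute moment.\<close>

lemma (in prob_space) expectation_normal_kernel_abs:
  assumes indep: "indep_var borel X borel T"
    and \<sigma>: "0 < \<sigma>" and \<tau>: "0 < \<tau>" and \<epsilon>: "0 < \<epsilon>"
    and X: "distributed M lborel X (normal_density 0 \<sigma>)"
    and T: "distributed M lborel T (normal_density 0 \<tau>)"
  shows "(\<integral>\<^sup>+\<omega>. ennreal (normal_density 0 \<epsilon> (T \<omega> + m * X \<omega>) * \<bar>X \<omega>\<bar>) \<partial>M)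
     = ennreal (\<sigma> * sqrt (\<epsilon>\<^sup>2 + \<tau>\<^sup>2) / (pi * (\<epsilon>\<^sup>2 + \<tau>\<^sup>2 + (\<sigma> * m)\<^sup>2)))"
proof -
  have ind: "indep_var lborel X lborel T"
    using indep_var_compose[OF indep, of "\<lambda>x. x" lborel "\<lambda>x. x" lborel] by (simp add: comp_def)
  let ?g = "\<lambda>(x, t). ennreal (normal_density 0 \<epsilon> (t + m * x) * \<bar>x\<bar>)"
  have "distributed M (lborel \<Otimes>\<^sub>M lborel) (\<lambda>\<omega>. (X \<omega>, T \<omega>)) (\<lambda>(x, t). ennreal (normal_density 0 \<sigma> x) * ennreal (normal_density 0 \<tau> t))"
    by (rule distributed_joint_indep[OF _ _ X T ind]) (rule lborel.sigma_finite_measure_axioms)+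
  from distributed_nn_integral[OF this, of ?g]
  have "(\<integral>\<^sup>+\<omega>. ennreal (normal_density 0 \<epsilon> (T \<omega> + m * X \<omega>) * \<bar>X \<omega>\<bar>) \<partial>M)
     = (\<integral>\<^sup>+z. (case z of (x, t) \<Rightarrow> ennreal (normal_density 0 \<sigma> x) * ennreal (normal_density 0 \<tau> t)) * ?g z \<partial>(lborel \<Otimes>\<^sub>M lborel))"
    by simp
  also have "\<dots> = (\<integral>\<^sup>+x. \<integral>\<^sup>+t. ennreal (normal_density 0 \<sigma> x) * ennreal (normal_density 0 \<tau> t) * ?g (x, t) \<partial>lborel \<partial>lborel)"
    by (subst lborel.nn_integral_fst[symmetric]) simp_all
  also have "\<dots> = (\<integral>\<^sup>+x. ennreal (normal_density 0 \<sigma> x * (normal_density 0 (sqrt (\<epsilon>\<^sup>2 + \<tau>\<^sup>2)) (m * x) * \<bar>x\<bar>)) \<partial>lborel)"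
  proof (rule nn_integral_cong)
    fix x :: real
    have "(\<integral>\<^sup>+t. ennreal (normal_density 0 \<sigma> x) * ennreal (normal_density 0 \<tau> t) * ?g (x, t) \<partial>lborel)
      = (\<integral>\<^sup>+t. ennreal (normal_density 0 \<sigma> x * \<bar>x\<bar>) * ennreal (normal_density 0 \<epsilon> (- (m * x) - t) * normal_density 0 \<tau> t) \<partial>lborel)"
    proof (rule nn_integral_cong)
      fix t :: real
      have "normal_density 0 \<epsilon> (- (m * x) - t) = normal_density 0 \<epsilon> (t + m * x)"
      proof -
        have "(- (m * x) - t)\<^sup>2 = (t + m * x)\<^sup>2"
          by (simp add: power2_eq_square algebra_simps)
        then show ?thesis by (simp add: normal_density_def)
      qed
      then show "ennreal (normal_density 0 \<sigma> x) * ennreal (normal_density 0 \<tau> t) * ?g (x, t)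
         = ennreal (normal_density 0 \<sigma> x * \<bar>x\<bar>) * ennreal (normal_density 0 \<epsilon> (- (m * x) - t) * normal_density 0 \<tau> t)"
        by (simp add: ennreal_mult'[symmetric] ennreal_mult''[symmetric] mult_ac)
    qed
    also have "\<dots> = ennreal (normal_density 0 \<sigma> x * \<bar>x\<bar>) * ennreal (normal_density 0 (sqrt (\<epsilon>\<^sup>2 + \<tau>\<^sup>2)) (- (m * x)))"
      using fun_cong[OF conv_normal_density_zero_mean[OF \<epsilon> \<tau>], of "- (m * x)"]
      by (subst nn_integral_cmult) auto
    also have "\<dots> = ennreal (normal_density 0 \<sigma> x * (normal_density 0 (sqrt (\<epsilon>\<^sup>2 + \<tau>\<^sup>2)) (m * x) * \<bar>x\<bar>))"
    proof -
      have "normal_density 0 (sqrt (\<epsilon>\<^sup>2 + \<tau>\<^sup>2)) (- (m * x)) = normal_density 0 (sqrt (\<epsilon>\<^sup>2 + \<tau>\<^sup>2)) (m * x)"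
        by (simp add: normal_density_def)
      then show ?thesis
        by (subst ennreal_mult'[symmetric]) (simp_all add: mult_ac)
    qed
    finally show "(\<integral>\<^sup>+t. ennreal (normal_density 0 \<sigma> x) * ennreal (normal_density 0 \<tau> t) * ?g (x, t) \<partial>lborel)
      = ennreal (normal_density 0 \<sigma> x * (normal_density 0 (sqrt (\<epsilon>\<^sup>2 + \<tau>\<^sup>2)) (m * x) * \<bar>x\<bar>))" .
  qed
  also have "\<dots> = ennreal (\<sigma> * sqrt (\<epsilon>\<^sup>2 + \<tau>\<^sup>2) / (pi * (\<epsilon>\<^sup>2 + \<tau>\<^sup>2 + (\<sigma> * m)\<^sup>2)))"
    using \<sigma> \<tau> \<epsilon> by (subst nn_integral_abs_normal_densities) (auto simp: add_pos_pos)
  finally show ?thesis .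
qed

text \<open>As a function of \<open>S\<close>, the quotient \<open>sqrt S / (S + w)\<close> decreases for \<open>S \<ge> w\<close>. For \<open>w \<le> 1 \<le> S\<close> it is
therefore largest at \<open>S = 1\<close>. The factor \<open>K\<close> leaves room for monomials slightly above 1: after
replacing \<open>(K * u)\<^sup>2\<close> in the denominator by the smaller \<open>u\<^sup>2\<close> one is back in this situation.\<close>

lemma angular_speed_le:
  fixes K S u :: real
  assumes K: "1 \<le> K" and S: "1 \<le> S" and u: "0 \<le> u" "u \<le> 1"
  shows "K * u * sqrt S / (S + (K * u)\<^sup>2) \<le> K * (u / (1 + u\<^sup>2))"
proof -
  have w: "u\<^sup>2 \<le> 1" using u by (simp add: power_le_one)
  have s: "1 \<le> sqrt S" using S by simp
  have "0 \<le> (sqrt S - 1) * (sqrt S - u\<^sup>2)" using s w by (intro mult_nonneg_nonneg) linarith+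
  then have 1: "sqrt S * (1 + u\<^sup>2) \<le> S + u\<^sup>2"
    using S by (simp add: algebra_simps)
  have "u\<^sup>2 \<le> (K * u)\<^sup>2" using K u by (intro power_mono) (auto simp: mult_le_cancel_right1)
  then have "sqrt S * (1 + u\<^sup>2) \<le> S + (K * u)\<^sup>2" using 1 by linarith
  moreover have "0 < S + (K * u)\<^sup>2" "0 < 1 + u\<^sup>2" using S by (simp_all add: add_pos_nonneg)
  ultimately have "sqrt S / (S + (K * u)\<^sup>2) \<le> 1 / (1 + u\<^sup>2)"
    by (simp add: field_simps)
  then have "(K * u) * (sqrt S / (S + (K * u)\<^sup>2)) \<le> (K * u) * (1 / (1 + u\<^sup>2))"
    using K u by (intro mult_left_mono) auto
  then show ?thesis by simp
qed

text \<open>The terms other than the one with index \<open>b\<close> add up to an independent centered Gaussian. Its variance is at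
least that of the term with index \<open>a\<close>, which is 1, and this makes the bound independent of \<open>\<epsilon>\<close>.
The right-hand side is the derivative of \<open>K / pi * arctan u\<close> in the direction of the logarithm
of \<open>u = \<sigma> b * w b / K\<close>.\<close>

lemma (in prob_space) expectation_normal_kernel_coefficient_le:
  assumes fin: "finite A" and a: "a \<in> A" and b: "b \<in> A" "b \<noteq> a"
    and indep: "indep_vars (\<lambda>_. borel) X A"
    and normal: "\<And>\<alpha>. \<alpha> \<in> A \<Longrightarrow> distributed M lborel (X \<alpha>) (normal_density 0 (\<sigma> \<alpha>))"
    and \<sigma>: "\<And>\<alpha>. \<alpha> \<in> A \<Longrightarrow> 0 < \<sigma> \<alpha>" and \<sigma>a: "\<sigma> a = 1"
    and w: "\<And>\<alpha>. \<alpha> \<in> A \<Longrightarrow> 0 < w \<alpha>" and wa: "w a = 1"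
    and \<epsilon>: "0 < \<epsilon>" and K: "1 \<le> K" and le: "\<sigma> b * w b \<le> K"
  shows "(\<integral>\<^sup>+\<omega>. ennreal (normal_density 0 \<epsilon> (\<Sum>\<alpha>\<in>A. X \<alpha> \<omega> * w \<alpha>) * (\<bar>X b \<omega>\<bar> * w b)) \<partial>M)
     \<le> ennreal (K / pi * ((\<sigma> b * w b / K) / (1 + (\<sigma> b * w b / K)\<^sup>2)))"
proof -
  let ?T = "\<lambda>\<omega>. \<Sum>\<alpha>\<in>A - {b}. X \<alpha> \<omega> * w \<alpha>"
  define \<tau> where "\<tau> = sqrt (\<Sum>\<alpha>\<in>A - {b}. (\<sigma> \<alpha> * w \<alpha>)\<^sup>2)"
  have ind': "indep_vars (\<lambda>_. borel) (\<lambda>\<alpha> \<omega>. X \<alpha> \<omega> * w \<alpha>) A"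
    by (rule indep_vars_compose2[OF indep]) auto
  have scaled: "distributed M lborel (\<lambda>\<omega>. X \<alpha> \<omega> * w \<alpha>) (normal_density 0 (\<sigma> \<alpha> * w \<alpha>))" if "\<alpha> \<in> A" for \<alpha>
    using normal_density_affine[OF normal[OF that] \<sigma>[OF that], of "w \<alpha>" 0] w[OF that] by (simp add: mult.commute)
  have "distributed M lborel ?T (normal_density (\<Sum>\<alpha>\<in>A - {b}. 0) \<tau>)"
    unfolding \<tau>_def
  proof (rule sum_indep_normal)
    show "indep_vars (\<lambda>i. borel) (\<lambda>\<alpha> \<omega>. X \<alpha> \<omega> * w \<alpha>) (A - {b})"
      by (rule indep_vars_subset[OF ind']) auto
  qed (use fin a b \<sigma> w scaled in auto)
  then have T: "distributed M lborel ?T (normal_density 0 \<tau>)" by simp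
  have "insert b (A - {b}) = A" using b by auto
  then have "indep_var borel (\<lambda>\<omega>. X b \<omega> * w b) borel ?T"
    using indep_vars_sum[of "A - {b}" b "\<lambda>\<alpha> \<omega>. X \<alpha> \<omega> * w \<alpha>"] fin ind' by simp
  then have "indep_var borel ((\<lambda>x. x / w b) \<circ> (\<lambda>\<omega>. X b \<omega> * w b)) borel ((\<lambda>x. x) \<circ> ?T)"
    by (rule indep_var_compose) auto
  moreover have "(\<lambda>x. x / w b) \<circ> (\<lambda>\<omega>. X b \<omega> * w b) = X b"
    using w[OF b(1)] by (auto simp: fun_eq_iff)
  ultimately have ind: "indep_var borel (X b) borel ?T"
    by (simp only: comp_def)
  have "(\<sigma> a * w a)\<^sup>2 \<le> (\<Sum>\<alpha>\<in>A - {b}. (\<sigma> \<alpha> * w \<alpha>)\<^sup>2)"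
    using fin a b by (intro member_le_sum) auto
  then have \<tau>: "1 \<le> \<tau>" "1 \<le> \<tau>\<^sup>2" using \<sigma>a wa by (auto simp: \<tau>_def sum_nonneg)
  have sum: "(\<Sum>\<alpha>\<in>A. X \<alpha> \<omega> * w \<alpha>) = ?T \<omega> + w b * X b \<omega>" for \<omega>
    using fin b by (subst sum.remove[of A b]) auto
  define u where "u = \<sigma> b * w b / K"
  have u: "0 \<le> u" "u \<le> 1" "\<sigma> b * w b = K * u"
    using le K \<sigma>[OF b(1)] w[OF b(1)] by (auto simp: u_def field_simps)
  have "(\<integral>\<^sup>+\<omega>. ennreal (normal_density 0 \<epsilon> (\<Sum>\<alpha>\<in>A. X \<alpha> \<omega> * w \<alpha>) * (\<bar>X b \<omega>\<bar> * w b)) \<partial>M)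
     = (\<integral>\<^sup>+\<omega>. ennreal (w b) * ennreal (normal_density 0 \<epsilon> (?T \<omega> + w b * X b \<omega>) * \<bar>X b \<omega>\<bar>) \<partial>M)"
    unfolding sum using w[OF b(1)] by (simp add: ennreal_mult'[symmetric] mult_ac)
  also have "\<dots> = ennreal (w b) * (\<integral>\<^sup>+\<omega>. ennreal (normal_density 0 \<epsilon> (?T \<omega> + w b * X b \<omega>) * \<bar>X b \<omega>\<bar>) \<partial>M)"
    using distributed_measurable[OF T] distributed_measurable[OF normal[OF b(1)]]
    by (intro nn_integral_cmult) auto
  also have "\<dots> = ennreal (w b) * ennreal (\<sigma> b * sqrt (\<epsilon>\<^sup>2 + \<tau>\<^sup>2) / (pi * (\<epsilon>\<^sup>2 + \<tau>\<^sup>2 + (\<sigma> b * w b)\<^sup>2)))"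
    using \<tau> \<epsilon> by (subst expectation_normal_kernel_abs[OF ind \<sigma>[OF b(1)] _ _ normal[OF b(1)] T]) auto
  also have "\<dots> = ennreal (w b * (\<sigma> b * sqrt (\<epsilon>\<^sup>2 + \<tau>\<^sup>2) / (pi * (\<epsilon>\<^sup>2 + \<tau>\<^sup>2 + (\<sigma> b * w b)\<^sup>2))))"
    using w[OF b(1)] by (intro ennreal_mult'[symmetric]) auto
  also have "w b * (\<sigma> b * sqrt (\<epsilon>\<^sup>2 + \<tau>\<^sup>2) / (pi * (\<epsilon>\<^sup>2 + \<tau>\<^sup>2 + (\<sigma> b * w b)\<^sup>2)))
     = 1 / pi * (\<sigma> b * w b * sqrt (\<epsilon>\<^sup>2 + \<tau>\<^sup>2) / (\<epsilon>\<^sup>2 + \<tau>\<^sup>2 + (\<sigma> b * w b)\<^sup>2))"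
    by simp
  also have "\<dots> \<le> 1 / pi * (K * (u / (1 + u\<^sup>2)))"
    unfolding u(3) using K \<tau> u by (intro mult_left_mono angular_speed_le) (auto simp: add_increasing)
  finally show ?thesis
    by (simp add: u_def[symmetric] ennreal_leI)
qed

section \<open>Monomials and normalized systems\<close>

text \<open>The gradient of the logarithm of the monomial with exponent \<open>\<alpha>\<close>.\<close>

definition log_gradient :: "real ^ 'n \<Rightarrow> real ^ 'n \<Rightarrow> real ^ 'n" where
  "log_gradient \<alpha> x = (\<chi> l. \<alpha> $ l / x $ l)"

text \<open>Component \<open>k\<close> is divided by the monomial with exponent \<open>a k\<close>. This keeps the zeros in the orthant
and makes the coefficient of \<open>a k\<close> a constant term, which drops out of the Jacobian.\<close>

definition normalized_system ::
    "('n \<Rightarrow> real ^ 'n) \<Rightarrow> ('n \<Rightarrow> (real ^ 'n) set) \<Rightarrow> ('n \<Rightarrow> real ^ 'n \<Rightarrow> real) \<Rightarrow> real ^ 'n \<Rightarrow> real ^ 'n" where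
  "normalized_system a A c x = (\<chi> k. \<Sum>\<alpha>\<in>A k. c k \<alpha> * monomial_fun (\<alpha> - a k) x)"

definition normalized_jacobian ::
    "('n \<Rightarrow> real ^ 'n) \<Rightarrow> ('n \<Rightarrow> (real ^ 'n) set) \<Rightarrow> ('n \<Rightarrow> real ^ 'n \<Rightarrow> real) \<Rightarrow> real ^ 'n \<Rightarrow> real ^ 'n ^ 'n" where
  "normalized_jacobian a A c x = (\<chi> k. \<Sum>\<alpha>\<in>A k. (c k \<alpha> * monomial_fun (\<alpha> - a k) x) *\<^sub>R log_gradient (\<alpha> - a k) x)"

lemma monomial_fun_eq_exp:
  "x \<in> positive_orthant \<Longrightarrow> monomial_fun \<alpha> x = exp (\<alpha> \<bullet> (\<chi> l. ln (x $ l)))"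
  by (auto simp: monomial_fun_def positive_orthant_def powr_def inner_vec_def exp_sum less_imp_neq[THEN not_sym])

lemma monomial_fun_pos: "x \<in> positive_orthant \<Longrightarrow> 0 < monomial_fun \<alpha> x"
  by (simp add: monomial_fun_eq_exp)

lemma monomial_fun_zero: "x \<in> positive_orthant \<Longrightarrow> monomial_fun 0 x = 1"
  by (simp add: monomial_fun_eq_exp)

lemma monomial_fun_diff:
  "x \<in> positive_orthant \<Longrightarrow> monomial_fun (\<alpha> - \<beta>) x = monomial_fun \<alpha> x / monomial_fun \<beta> x"
  by (simp add: monomial_fun_eq_exp inner_diff_left exp_diff)

lemma log_gradient_diff: "log_gradient (\<alpha> - \<beta>) x = log_gradient \<alpha> x - log_gradient \<beta> x"
  by (simp add: log_gradient_def vec_eq_iff diff_divide_distrib)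

lemma open_positive_orthant: "open (positive_orthant :: (real ^ 'n::finite) set)"
proof -
  have "(positive_orthant :: (real ^ 'n) set) = (\<Inter>i. {x :: real ^ 'n. 0 < x $ i})"
    by (auto simp: positive_orthant_def)
  moreover have "open (\<Inter>i. {x :: real ^ 'n. 0 < x $ i})"
    by (intro open_INT ballI finite open_Collect_less continuous_intros)
  ultimately show ?thesis by metis
qed

lemma has_derivative_monomial_fun:
  fixes x :: "real ^ 'n::finite"
  assumes x: "x \<in> positive_orthant"
  shows "(monomial_fun \<alpha> has_derivative (\<lambda>h. monomial_fun \<alpha> x * (log_gradient \<alpha> x \<bullet> h))) (at x)"
proof -
  have pos: "0 < x $ l" for l using x by (simp add: positive_orthant_def)
  have "((\<lambda>y. exp (\<Sum>l\<in>UNIV. \<alpha> $ l * ln (y $ l))) has_derivative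
      (\<lambda>h. (\<Sum>l\<in>UNIV. \<alpha> $ l * (h $ l * inverse (x $ l))) * exp (\<Sum>l\<in>UNIV. \<alpha> $ l * ln (x $ l)))) (at x)"
    using pos
    by (auto intro!: derivative_eq_intros bounded_linear.has_derivative[OF bounded_linear_vec_nth] simp: mult_ac)
  then have "((\<lambda>y. exp (\<alpha> \<bullet> (\<chi> l. ln (y $ l)))) has_derivative (\<lambda>h. monomial_fun \<alpha> x * (log_gradient \<alpha> x \<bullet> h))) (at x)"
    by (simp add: monomial_fun_eq_exp[OF x] inner_vec_def log_gradient_def divide_inverse mult_ac)
  then show ?thesis
    by (rule has_derivative_transform_within_open[OF _ open_positive_orthant x]) (simp add: monomial_fun_eq_exp)
qed

lemma continuous_on_monomial_fun: "continuous_on positive_orthant (monomial_fun (\<alpha> :: real ^ 'n::finite))"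
  by (meson continuous_at_imp_continuous_on has_derivative_continuous has_derivative_monomial_fun)

lemma borel_measurable_monomial_fun [measurable]: "monomial_fun \<alpha> \<in> borel_measurable borel"
  unfolding monomial_fun_def by measurable

lemma continuous_on_log_gradient: "continuous_on positive_orthant (log_gradient (\<alpha> :: real ^ 'n::finite))"
  unfolding log_gradient_def
  by (intro continuous_intros) (auto simp: positive_orthant_def less_imp_neq[THEN not_sym])

lemma has_derivative_normalized_system:
  fixes x :: "real ^ 'n::finite"
  assumes x: "x \<in> positive_orthant"
  shows "(normalized_system a A c has_derivative (*v) (normalized_jacobian a A c x)) (at x)"
proof -
  have "((\<lambda>x. \<chi> k. \<Sum>\<alpha>\<in>A k. c k \<alpha> * monomial_fun (\<alpha> - a k) x) has_derivative
     (\<lambda>h. \<chi> k. \<Sum>\<alpha>\<in>A k. c k \<alpha> * (monomial_fun (\<alpha> - a k) x * (log_gradient (\<alpha> - a k) x \<bullet> h)))) (at x)"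
    by (subst has_derivative_componentwise_within)
      (auto simp: Basis_vec_real inner_axis intro!: has_derivative_sum has_derivative_mult_right has_derivative_monomial_fun x)
  also have "(\<lambda>h. \<chi> k. \<Sum>\<alpha>\<in>A k. c k \<alpha> * (monomial_fun (\<alpha> - a k) x * (log_gradient (\<alpha> - a k) x \<bullet> h)))
      = (*v) (normalized_jacobian a A c x)"
    by (simp add: fun_eq_iff vec_eq_iff matrix_vector_mul_component normalized_jacobian_def inner_sum_left mult.assoc)
  finally show ?thesis by (simp add: normalized_system_def[abs_def])
qed

lemma continuous_on_normalized_jacobian:
  "continuous_on positive_orthant (normalized_jacobian (a :: 'n::finite \<Rightarrow> real ^ 'n) A c)"
  unfolding normalized_jacobian_def
  by (intro continuous_intros continuous_on_monomial_fun continuous_on_log_gradient)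

text \<open>At a zero of component \<open>k\<close> the multiple of \<open>log_gradient (a k) x\<close> by which the two gradients differ
has coefficient 0. Hence the rows of the two Jacobians agree up to the positive monomial factors.\<close>

lemma regular_zero_normalized:
  fixes x :: "real ^ 'n::finite"
  assumes x: "x \<in> positive_orthant"
    and zero: "fewnomial_system A c x = 0"
    and reg: "det (jacobian (fewnomial_system A c) (at x)) \<noteq> 0"
  shows "normalized_system a A c x = 0" "det (normalized_jacobian a A c x) \<noteq> 0"
proof -
  let ?m = "\<lambda>k. monomial_fun (a k) x"
  have m: "?m k \<noteq> 0" for k using monomial_fun_pos[OF x, of "a k"] by simp
  have z: "(\<Sum>\<alpha>\<in>A k. c k \<alpha> * monomial_fun \<alpha> x) = 0" for k
    using zero by (simp add: fewnomial_system_def vec_eq_iff)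
  show "normalized_system a A c x = 0"
    using z by (simp add: normalized_system_def vec_eq_iff monomial_fun_diff[OF x] sum_divide_distrib[symmetric])
  have "fewnomial_system A c = normalized_system (\<lambda>_. 0) A c"
    by (simp add: fun_eq_iff fewnomial_system_def normalized_system_def)
  then have "jacobian (fewnomial_system A c) (at x) = normalized_jacobian (\<lambda>_. 0) A c x"
    using has_derivative_normalized_system[OF x, of "\<lambda>_. 0" A c, THEN frechet_derivative_at]
    by (metis jacobian_def matrix_of_matrix_vector_mul)
  also have "\<dots> = (\<chi> k. ?m k *s (normalized_jacobian a A c x $ k))"
  proof -
    have "(\<Sum>\<alpha>\<in>A k. (c k \<alpha> * monomial_fun \<alpha> x) *\<^sub>R log_gradient \<alpha> x)
       = (\<Sum>\<alpha>\<in>A k. (c k \<alpha> * monomial_fun \<alpha> x) *\<^sub>R log_gradient (\<alpha> - a k) x)" for k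
      using z[of k] by (simp add: log_gradient_diff scaleR_diff_right sum_subtractf scaleR_left.sum[symmetric])
    moreover have "\<dots> k = ?m k *s (normalized_jacobian a A c x $ k)" for k
      using m by (simp add: normalized_jacobian_def scalar_mult_eq_scaleR scaleR_sum_right monomial_fun_diff[OF x])
    ultimately show ?thesis
      by (simp add: normalized_jacobian_def[of "\<lambda>_. 0"] vec_eq_iff)
  qed
  also have "det \<dots> = (\<Prod>k\<in>UNIV. ?m k) * det (normalized_jacobian a A c x)"
    by (subst det_rows_mul) (simp add: vec_lambda_eta)
  finally show "det (normalized_jacobian a A c x) \<noteq> 0"
    using reg by auto
qed

lemma det_sum_rows:
  fixes r :: "'n::finite \<Rightarrow> 'b \<Rightarrow> real ^ 'n"
  assumes "\<And>k. finite (B k)"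
  shows "det (\<chi> k. \<Sum>\<alpha>\<in>B k. r k \<alpha>) = (\<Sum>b\<in>PiE UNIV B. det (\<chi> k. r k (b k)))"
proof -
  have "det (\<chi> k. \<Sum>\<alpha>\<in>B k. r k \<alpha>)
     = (\<Sum>p | p permutes UNIV. of_int (sign p) * (\<Prod>k\<in>UNIV. \<Sum>\<alpha>\<in>B k. r k \<alpha> $ p k))"
    by (simp add: det_def)
  also have "\<dots> = (\<Sum>p | p permutes UNIV. \<Sum>b\<in>PiE UNIV B. of_int (sign p) * (\<Prod>k\<in>UNIV. r k (b k) $ p k))"
    using assms by (simp add: prod_sum_PiE sum_distrib_left)
  also have "\<dots> = (\<Sum>b\<in>PiE UNIV B. det (\<chi> k. r k (b k)))"
    by (subst sum.swap) (simp add: det_def)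
  finally show ?thesis .
qed

text \<open>Multilinearity of the determinant. The exponent \<open>a k\<close> contributes nothing to row \<open>k\<close>, since after
normalization its monomial is constant.\<close>

lemma det_normalized_jacobian:
  fixes x :: "real ^ 'n::finite"
  assumes "\<And>k. finite (A k)"
  shows "det (normalized_jacobian a A c x) = (\<Sum>b\<in>PiE UNIV (\<lambda>k. A k - {a k}).
      (\<Prod>k\<in>UNIV. c k (b k) * monomial_fun (b k - a k) x) * det (\<chi> k. log_gradient (b k - a k) x))"
proof -
  have "normalized_jacobian a A c x
     = (\<chi> k. \<Sum>\<alpha>\<in>A k - {a k}. (c k \<alpha> * monomial_fun (\<alpha> - a k) x) *s log_gradient (\<alpha> - a k) x)"
    unfolding normalized_jacobian_def scalar_mult_eq_scaleR vec_eq_iff[of "vec_lambda _"] vec_lambda_beta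
    using assms by (intro allI arg_cong2[of _ _ _ _ vec_nth] sum.mono_neutral_right refl) (auto simp: log_gradient_def vec_eq_iff)
  then show ?thesis
    using assms by (simp add: det_sum_rows det_rows_mul)
qed

section \<open>The expected number of zeros in a chart\<close>

lemma nn_integral_arctan_density:
  "(\<integral>\<^sup>+t. ennreal (c / (1 + t\<^sup>2) * indicat_real {0..1} t) \<partial>lborel) = ennreal (c * pi / 4)" if c: "0 \<le> c" for c :: real
proof -
  have "(\<integral>\<^sup>+t. ennreal (c / (1 + t\<^sup>2)) * indicator {0..1} t \<partial>lborel) = ennreal (c * arctan 1 - c * arctan 0)"
    using c
    by (intro nn_integral_FTC_Icc)
      (auto intro!: derivative_eq_intros simp: add_nonneg_eq_0_iff divide_inverse)
  moreover have "(\<integral>\<^sup>+t. ennreal (c / (1 + t\<^sup>2) * indicat_real {0..1} t) \<partial>lborel)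
      = (\<integral>\<^sup>+t. ennreal (c / (1 + t\<^sup>2)) * indicator {0..1} t \<partial>lborel)"
    by (intro nn_integral_cong) (auto simp: indicator_def)
  ultimately show ?thesis by (simp add: arctan_one)
qed

text \<open>In logarithmic coordinates the monomial map is linear with rows \<open>\<beta> k\<close>; evaluating the logarithmic
gradients at \<open>x0\<close> only rescales the columns of this matrix.\<close>

lemma inj_on_monomials:
  fixes \<beta> :: "'n::finite \<Rightarrow> real ^ 'n"
  assumes U: "U \<subseteq> positive_orthant" and x0: "x0 \<in> positive_orthant"
    and det: "det (\<chi> k. log_gradient (\<beta> k) x0) \<noteq> 0"
    and s: "\<And>k. s k \<noteq> 0"
  shows "inj_on (\<lambda>x. \<chi> k. s k * monomial_fun (\<beta> k) x) U"
proof (rule inj_onI)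
  fix x y assume xy: "x \<in> U" "y \<in> U" and eq: "(\<chi> k. s k * monomial_fun (\<beta> k) x) = (\<chi> k. s k * monomial_fun (\<beta> k) y)"
  have x: "x \<in> positive_orthant" and y: "y \<in> positive_orthant" using U xy by auto
  \<comment> \<open>The rescaling by \<open>x0\<close> cancels the denominators of the logarithmic gradients.\<close>
  define h where "h = (\<chi> l. x0 $ l * (ln (x $ l) - ln (y $ l)))"
  have "monomial_fun (\<beta> k) x = monomial_fun (\<beta> k) y" for k
    using arg_cong[OF eq, of "\<lambda>v. v $ k"] s[of k] by simp
  then have ortho: "\<beta> k \<bullet> (\<chi> l. ln (x $ l)) = \<beta> k \<bullet> (\<chi> l. ln (y $ l))" for k
    by (simp add: monomial_fun_eq_exp[OF x] monomial_fun_eq_exp[OF y])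
  have "log_gradient (\<beta> k) x0 \<bullet> h = \<beta> k \<bullet> (\<chi> l. ln (x $ l)) - \<beta> k \<bullet> (\<chi> l. ln (y $ l))" for k
    unfolding inner_vec_def log_gradient_def h_def sum_subtractf[symmetric]
    using x0 by (intro sum.cong) (auto simp: positive_orthant_def less_imp_neq[THEN not_sym] algebra_simps)
  then have "(\<chi> k. log_gradient (\<beta> k) x0) *v h = 0"
    using ortho by (simp add: vec_eq_iff matrix_vector_mul_component)
  then have "h = 0"
    using det by (metis invertible_det_nz matrix_left_invertible_ker invertible_def)
  then have "ln (x $ l) = ln (y $ l)" for l
    using x0 by (auto simp: h_def vec_eq_iff positive_orthant_def less_imp_neq[THEN not_sym])
  then show "x = y"
    using x y by (auto simp: vec_eq_iff positive_orthant_def)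
qed

text \<open>With \<open>u k = s k * monomial_fun (\<beta> k) x / K\<close> the integrand is the Jacobian determinant of \<open>u\<close> times the product of
the functions \<open>K / (pi * (1 + (u k)\<^sup>2))\<close>. Since \<open>u\<close> is injective with values in the unit cube, the
integral is at most the product of the numbers \<open>K / pi * arctan 1 = K / 4\<close>. If \<open>u\<close> is nowhere
regular, the integral is 0.\<close>

lemma nn_integral_monomial_chart_le:
  fixes \<beta> :: "'n::finite \<Rightarrow> real ^ 'n"
  assumes U: "open U" "U \<subseteq> positive_orthant"
    and K: "0 < K" and s: "\<And>k. 0 < s k"
    and le: "\<And>x k. x \<in> U \<Longrightarrow> s k * monomial_fun (\<beta> k) x \<le> K"
  shows "(\<integral>\<^sup>+x\<in>U. ennreal (\<bar>det (\<chi> k. log_gradient (\<beta> k) x)\<bar>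
        * (\<Prod>k\<in>UNIV. K / pi * ((s k * monomial_fun (\<beta> k) x / K) / (1 + (s k * monomial_fun (\<beta> k) x / K)\<^sup>2)))) \<partial>lborel)
     \<le> ennreal ((K / 4) ^ CARD('n))"
proof (cases "\<exists>x0\<in>U. det (\<chi> k. log_gradient (\<beta> k) x0) \<noteq> 0")
  case False
  then have "(\<integral>\<^sup>+x\<in>U. ennreal (\<bar>det (\<chi> k. log_gradient (\<beta> k) x)\<bar>
        * (\<Prod>k\<in>UNIV. K / pi * ((s k * monomial_fun (\<beta> k) x / K) / (1 + (s k * monomial_fun (\<beta> k) x / K)\<^sup>2)))) \<partial>lborel)
      = (\<integral>\<^sup>+x. 0 \<partial>(lborel :: (real^'n) measure))"
    by (intro nn_integral_cong) (auto split: split_indicator)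
  then show ?thesis by simp
next
  case True
  then obtain x0 where x0: "x0 \<in> U" "det (\<chi> k. log_gradient (\<beta> k) x0) \<noteq> 0" by blast
  define g where "g x = (\<chi> k. s k / K * monomial_fun (\<beta> k) x)" for x
  define J where "J x = (\<chi> k. (s k / K * monomial_fun (\<beta> k) x) *s log_gradient (\<beta> k) x)" for x
  define f where "f y = (\<Prod>k\<in>(UNIV::'n set). K / pi / (1 + (y $ k)\<^sup>2) * indicat_real {0..1} (y $ k))" for y :: "real^'n"
  have f0: "0 \<le> f y" for y
    using K by (auto simp: f_def intro!: prod_nonneg)
  have int_f: "(\<integral>\<^sup>+y. ennreal (f y) \<partial>lborel) = ennreal ((K / 4) ^ CARD('n))"
  proof -
    have "(\<integral>\<^sup>+y. ennreal (f y) \<partial>lborel)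
        = (\<integral>\<^sup>+y. (\<Prod>k\<in>UNIV. ennreal (K / pi / (1 + (y $ k)\<^sup>2) * indicat_real {0..1} (y $ k))) \<partial>(lborel :: (real^'n) measure))"
      using K by (simp add: f_def prod_ennreal)
    also have "\<dots> = (\<Prod>k\<in>(UNIV :: 'n set). ennreal (K / pi * pi / 4))"
    proof (subst nn_integral_prod_components[where h = "\<lambda>k t. ennreal (K / pi / (1 + t\<^sup>2) * indicat_real {0..1} t)"])
      show "(\<lambda>t. ennreal (K / pi / (1 + t\<^sup>2) * indicat_real {0..1} t)) \<in> borel_measurable borel"
        by simp
      show "(\<Prod>k\<in>(UNIV :: 'n set). \<integral>\<^sup>+t. ennreal (K / pi / (1 + t\<^sup>2) * indicat_real {0..1} t) \<partial>lborel)
          = (\<Prod>k\<in>(UNIV :: 'n set). ennreal (K / pi * pi / 4))"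
        using K by (subst nn_integral_arctan_density) simp_all
    qed
    finally show ?thesis using K by (simp add: ennreal_power)
  qed
  have fm: "f \<in> borel_measurable borel" unfolding f_def by measurable
  have fi: "integrable lborel f"
    using fm f0 int_f by (intro integrableI_nonneg) auto
  have pos: "x \<in> positive_orthant" if "x \<in> U" for x using U that by auto
  have der: "(g has_derivative (*v) (J x)) (at x)" if x: "x \<in> U" for x
  proof -
    have "((\<lambda>x. \<chi> k. c k * monomial_fun (\<beta> k) x) has_derivative
        (\<lambda>h. \<chi> k. c k * (monomial_fun (\<beta> k) x * (log_gradient (\<beta> k) x \<bullet> h)))) (at x)" for c
      by (subst has_derivative_componentwise_within)
        (auto simp: Basis_vec_real inner_axis intro!: has_derivative_mult_right has_derivative_monomial_fun pos[OF x])
    from this[of "\<lambda>k. s k / K"]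
    have "((\<lambda>x. \<chi> k. s k / K * monomial_fun (\<beta> k) x) has_derivative
        (\<lambda>h. \<chi> k. s k / K * (monomial_fun (\<beta> k) x * (log_gradient (\<beta> k) x \<bullet> h)))) (at x)" .
    also have "(\<lambda>h. \<chi> k. s k / K * (monomial_fun (\<beta> k) x * (log_gradient (\<beta> k) x \<bullet> h))) = (*v) (J x)"
      by (simp add: fun_eq_iff vec_eq_iff matrix_vector_mul_component J_def scalar_mult_eq_scaleR)
    finally show ?thesis by (simp add: g_def[abs_def])
  qed
  have inj: "inj_on g U"
    unfolding g_def using U x0 pos K s by (intro inj_on_monomials[of _ x0]) (auto simp: less_imp_neq[THEN not_sym])
  have "continuous_on U J"
    unfolding J_def scalar_mult_eq_scaleR using U
    by (intro continuous_intros continuous_on_subset[OF continuous_on_monomial_fun] continuous_on_subset[OF continuous_on_log_gradient])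
  then have Jm: "J \<in> borel_measurable (restrict_space borel U)"
    by (rule borel_measurable_continuous_on_restrict)
  have "(\<integral>\<^sup>+x\<in>U. ennreal (\<bar>det (\<chi> k. log_gradient (\<beta> k) x)\<bar>
        * (\<Prod>k\<in>UNIV. K / pi * ((s k * monomial_fun (\<beta> k) x / K) / (1 + (s k * monomial_fun (\<beta> k) x / K)\<^sup>2)))) \<partial>lborel)
     = (\<integral>\<^sup>+x\<in>U. ennreal (\<bar>det (J x)\<bar> * f (g x)) \<partial>lborel)"
  proof (intro nn_integral_cong)
    fix x
    show "ennreal (\<bar>det (\<chi> k. log_gradient (\<beta> k) x)\<bar>
        * (\<Prod>k\<in>UNIV. K / pi * ((s k * monomial_fun (\<beta> k) x / K) / (1 + (s k * monomial_fun (\<beta> k) x / K)\<^sup>2)))) * indicator U x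
      = ennreal (\<bar>det (J x)\<bar> * f (g x)) * indicator U x"
    proof (cases "x \<in> U")
      case True
      let ?u = "\<lambda>k. s k / K * monomial_fun (\<beta> k) x"
      have u: "0 \<le> ?u k" "?u k \<le> 1" for k
        using le[OF True, of k] s[of k] K monomial_fun_pos[OF pos[OF True], of "\<beta> k"] by (auto simp: field_simps)
      have "\<bar>det (J x)\<bar> = (\<Prod>k\<in>UNIV. ?u k) * \<bar>det (\<chi> k. log_gradient (\<beta> k) x)\<bar>"
        unfolding J_def det_rows_mul abs_mult using u(1) by (simp add: abs_prod del: times_divide_eq_left)
      moreover have "f (g x) = (\<Prod>k\<in>UNIV. K / pi / (1 + (?u k)\<^sup>2))"
        unfolding f_def g_def using u by (intro prod.cong) auto
      ultimately have "\<bar>det (J x)\<bar> * f (g x) = \<bar>det (\<chi> k. log_gradient (\<beta> k) x)\<bar> * (\<Prod>k\<in>UNIV. ?u k * (K / pi / (1 + (?u k)\<^sup>2)))"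
        by (simp only: prod.distrib mult_ac)
      also have "(\<lambda>k. ?u k * (K / pi / (1 + (?u k)\<^sup>2)))
          = (\<lambda>k. K / pi * ((s k * monomial_fun (\<beta> k) x / K) / (1 + (s k * monomial_fun (\<beta> k) x / K)\<^sup>2)))"
        by (simp add: fun_eq_iff)
      finally show ?thesis by (simp only:)
    qed simp
  qed
  also have "\<dots> = (\<integral>\<^sup>+y\<in>g ` U. ennreal (f y) \<partial>lborel)"
    by (rule nn_integral_change_of_variables[OF U(1) der inj Jm f0 fi])
  also have "\<dots> \<le> (\<integral>\<^sup>+y. ennreal (f y) \<partial>lborel)"
    by (intro nn_integral_mono) (auto split: split_indicator)
  finally show ?thesis unfolding int_f .
qed

text \<open>Each \<open>X (h j)\<close> is a function of the block of variables with the single index \<open>h j\<close>, and these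
blocks are disjoint.\<close>

lemma (in prob_space) indep_vars_inj:
  assumes ind: "indep_vars M' X I" and h: "inj_on h L" "h ` L \<subseteq> I"
  shows "indep_vars (\<lambda>j. M' (h j)) (\<lambda>j. X (h j)) L"
proof -
  have "indep_vars (\<lambda>j. PiM {h j} M') (\<lambda>j \<omega>. restrict (\<lambda>i. X i \<omega>) {h j}) L"
    using h by (intro indep_vars_restrict[OF ind]) (auto simp: disjoint_family_on_def inj_on_def)
  then have "indep_vars (\<lambda>j. M' (h j)) (\<lambda>j \<omega>. restrict (\<lambda>i. X i \<omega>) {h j} (h j)) L"
    by (rule indep_vars_compose2) (auto intro!: measurable_component_singleton)
  then show ?thesis by simp
qed

text \<open>Expanding the determinant row by row leaves, for each choice \<open>b\<close> of one exponent per row, a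
product over the rows. Coefficients of different rows are independent, so its expectation is a
product of expectations in a single row.\<close>

lemma (in prob_space) expectation_normalized_jacobian_le:
  fixes A :: "'n::finite \<Rightarrow> (real ^ 'n) set"
  assumes fin: "\<And>k. finite (A k)"
    and indep: "indep_vars (\<lambda>_. borel) (\<lambda>(k, \<alpha>). f k \<alpha>) (SIGMA k:UNIV. A k)"
    and normal: "\<And>k \<alpha>. \<alpha> \<in> A k \<Longrightarrow> distributed M lborel (f k \<alpha>) (normal_density 0 (\<sigma> k \<alpha>))"
    and \<sigma>: "\<And>k \<alpha>. \<alpha> \<in> A k \<Longrightarrow> 0 < \<sigma> k \<alpha>" "\<And>k \<alpha>. \<alpha> \<in> A k \<Longrightarrow> \<sigma> k \<alpha> \<le> 1"
    and a: "\<And>k. a k \<in> A k" "\<And>k. \<sigma> k (a k) = 1"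
    and x: "x \<in> positive_orthant"
    and K: "1 \<le> K" "\<And>k \<alpha>. \<alpha> \<in> A k \<Longrightarrow> monomial_fun (\<alpha> - a k) x \<le> K"
    and \<epsilon>: "0 < \<epsilon>"
  shows "(\<integral>\<^sup>+\<omega>. ennreal (\<bar>det (normalized_jacobian a A (\<lambda>k \<alpha>. f k \<alpha> \<omega>) x)\<bar>
        * (\<Prod>k\<in>UNIV. normal_density 0 \<epsilon> (normalized_system a A (\<lambda>k \<alpha>. f k \<alpha> \<omega>) x $ k))) \<partial>M)
     \<le> (\<Sum>b\<in>PiE UNIV (\<lambda>k. A k - {a k}). ennreal (\<bar>det (\<chi> k. log_gradient (b k - a k) x)\<bar>
        * (\<Prod>k\<in>UNIV. K / pi * ((\<sigma> k (b k) * monomial_fun (b k - a k) x / K) / (1 + (\<sigma> k (b k) * monomial_fun (b k - a k) x / K)\<^sup>2)))))"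
    (is "?L \<le> (\<Sum>b\<in>?B. ennreal (?D b * (\<Prod>k\<in>UNIV. ?r b k)))")
proof -
  let ?m = "\<lambda>k \<alpha>. monomial_fun (\<alpha> - a k) x"
  let ?F = "\<lambda>k \<omega>. \<Sum>\<alpha>\<in>A k. f k \<alpha> \<omega> * ?m k \<alpha>"
  let ?X = "\<lambda>b k \<omega>. normal_density 0 \<epsilon> (?F k \<omega>) * (\<bar>f k (b k) \<omega>\<bar> * ?m k (b k))"
  have m: "0 < ?m k \<alpha>" for k \<alpha> by (rule monomial_fun_pos[OF x])
  have fm [measurable]: "f k \<alpha> \<in> borel_measurable M" if "\<alpha> \<in> A k" for k \<alpha>
    using distributed_measurable[OF normal[OF that]] by simp
  have finB: "finite ?B" using fin by (intro finite_PiE) auto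
  have X0: "0 \<le> ?X b k \<omega>" for b k \<omega> using m[of "b k" k] by simp
  have Xm: "(\<lambda>\<omega>. ?X b k \<omega>) \<in> borel_measurable M" if "b \<in> ?B" for b k
  proof -
    have "b k \<in> A k" using that by auto
    then show ?thesis by measurable
  qed
  have r0: "0 \<le> ?r b k" if "b \<in> ?B" for b k
  proof -
    have "b k \<in> A k" using that by auto
    then show ?thesis
      using K m[of "b k" k] \<sigma>(1)[of "b k" k]
      by (intro mult_nonneg_nonneg divide_nonneg_nonneg add_nonneg_nonneg) auto
  qed
  have block: "(\<integral>\<^sup>+\<omega>. ennreal (?X b k \<omega>) \<partial>M) \<le> ennreal (?r b k)" if b: "b \<in> ?B" for b k
  proof (rule expectation_normal_kernel_coefficient_le)
    have bk: "b k \<in> A k" "b k \<noteq> a k" using b by auto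
    then show "b k \<in> A k" "b k \<noteq> a k" .
    show "indep_vars (\<lambda>_. borel) (f k) (A k)"
      using indep_vars_inj[OF indep, of "Pair k" "A k"] by (auto simp: inj_on_def)
    show "monomial_fun (a k - a k) x = 1" by (simp add: monomial_fun_zero[OF x])
    have "\<sigma> k (b k) * ?m k (b k) \<le> 1 * K"
      using \<sigma>[OF bk(1)] K m[of "b k" k] bk by (intro mult_mono) (auto simp: less_imp_le)
    then show "\<sigma> k (b k) * ?m k (b k) \<le> K" by simp
  qed (use fin a normal \<sigma> m \<epsilon> K in auto)
  have prod: "(\<integral>\<^sup>+\<omega>. ennreal (\<Prod>k\<in>UNIV. ?X b k \<omega>) \<partial>M) = (\<Prod>k\<in>UNIV. \<integral>\<^sup>+\<omega>. ennreal (?X b k \<omega>) \<partial>M)" if b: "b \<in> ?B" for b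
  proof -
    \<comment> \<open>Factor \<open>k\<close> depends only on the coefficients in row \<open>k\<close>.\<close>
    let ?K = "\<lambda>k. {k} \<times> A k"
    let ?Y = "\<lambda>k g. ennreal (normal_density 0 \<epsilon> (\<Sum>\<alpha>\<in>A k. g (k, \<alpha>) * ?m k \<alpha>) * (\<bar>g (k, b k)\<bar> * ?m k (b k)))"
    have bk: "b k \<in> A k" for k using b by auto
    have "indep_vars (\<lambda>k. PiM (?K k) (\<lambda>_. borel)) (\<lambda>k \<omega>. restrict (\<lambda>i. (case i of (k, \<alpha>) \<Rightarrow> f k \<alpha>) \<omega>) (?K k)) UNIV"
      by (rule indep_vars_restrict[OF indep]) (auto simp: disjoint_family_on_def)
    then have "indep_vars (\<lambda>_. borel) (\<lambda>k \<omega>. ?Y k (restrict (\<lambda>i. (case i of (k, \<alpha>) \<Rightarrow> f k \<alpha>) \<omega>) (?K k))) UNIV"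
    proof (rule indep_vars_compose2)
      fix k
      have [measurable]: "(\<lambda>g. g (k, \<alpha>)) \<in> borel_measurable (PiM (?K k) (\<lambda>_. borel))" if "\<alpha> \<in> A k" for \<alpha>
        using that by (intro measurable_component_singleton) auto
      show "?Y k \<in> borel_measurable (PiM (?K k) (\<lambda>_. borel))"
        using bk[of k] by measurable
    qed
    also have "(\<lambda>k \<omega>. ?Y k (restrict (\<lambda>i. (case i of (k, \<alpha>) \<Rightarrow> f k \<alpha>) \<omega>) (?K k))) = (\<lambda>k \<omega>. ennreal (?X b k \<omega>))"
      using bk by (intro ext) simp
    finally have "(\<integral>\<^sup>+\<omega>. (\<Prod>k\<in>UNIV. ennreal (?X b k \<omega>)) \<partial>M) = (\<Prod>k\<in>UNIV. \<integral>\<^sup>+\<omega>. ennreal (?X b k \<omega>) \<partial>M)"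
      by (intro indep_vars_nn_integral) auto
    then show ?thesis using X0 by (simp add: prod_ennreal)
  qed
  have "?L \<le> (\<integral>\<^sup>+\<omega>. (\<Sum>b\<in>?B. ennreal (?D b) * ennreal (\<Prod>k\<in>UNIV. ?X b k \<omega>)) \<partial>M)"
  proof (rule nn_integral_mono)
    fix \<omega>
    let ?J = "normalized_jacobian a A (\<lambda>k \<alpha>. f k \<alpha> \<omega>) x" and ?\<phi> = "\<Prod>k\<in>UNIV. normal_density 0 \<epsilon> (?F k \<omega>)"
    have "\<bar>det ?J\<bar> \<le> (\<Sum>b\<in>?B. \<bar>(\<Prod>k\<in>UNIV. f k (b k) \<omega> * ?m k (b k)) * det (\<chi> k. log_gradient (b k - a k) x)\<bar>)"
      unfolding det_normalized_jacobian[OF fin] by (rule sum_abs)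
    also have "\<dots> = (\<Sum>b\<in>?B. ?D b * (\<Prod>k\<in>UNIV. \<bar>f k (b k) \<omega>\<bar> * ?m k (b k)))"
      using m by (simp add: abs_mult abs_prod mult.commute less_imp_le abs_of_pos)
    finally have "\<bar>det ?J\<bar> * ?\<phi> \<le> (\<Sum>b\<in>?B. ?D b * (\<Prod>k\<in>UNIV. \<bar>f k (b k) \<omega>\<bar> * ?m k (b k))) * ?\<phi>"
      by (rule mult_right_mono) (auto intro: prod_nonneg)
    also have "\<dots> = (\<Sum>b\<in>?B. ?D b * (\<Prod>k\<in>UNIV. ?X b k \<omega>))"
      unfolding sum_distrib_right prod.distrib by (intro sum.cong) (simp_all only: mult_ac)
    finally have "ennreal (\<bar>det ?J\<bar> * ?\<phi>) \<le> ennreal (\<Sum>b\<in>?B. ?D b * (\<Prod>k\<in>UNIV. ?X b k \<omega>))"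
      by (rule ennreal_leI)
    also have "\<dots> = (\<Sum>b\<in>?B. ennreal (?D b) * ennreal (\<Prod>k\<in>UNIV. ?X b k \<omega>))"
      using X0 by (subst sum_ennreal[symmetric])
        (auto intro!: mult_nonneg_nonneg prod_nonneg sum.cong ennreal_mult' less_imp_le[OF m])
    finally show "ennreal (\<bar>det ?J\<bar> * (\<Prod>k\<in>UNIV. normal_density 0 \<epsilon> (normalized_system a A (\<lambda>k \<alpha>. f k \<alpha> \<omega>) x $ k)))
      \<le> (\<Sum>b\<in>?B. ennreal (?D b) * ennreal (\<Prod>k\<in>UNIV. ?X b k \<omega>))"
      by (simp add: normalized_system_def)
  qed
  also have "\<dots> = (\<Sum>b\<in>?B. ennreal (?D b) * (\<integral>\<^sup>+\<omega>. ennreal (\<Prod>k\<in>UNIV. ?X b k \<omega>) \<partial>M))"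
    using Xm by (subst nn_integral_sum) (auto intro!: sum.cong nn_integral_cmult borel_measurable_prod)
  also have "\<dots> \<le> (\<Sum>b\<in>?B. ennreal (?D b) * (\<Prod>k\<in>UNIV. ennreal (?r b k)))"
  proof (intro sum_mono mult_left_mono)
    fix b assume b: "b \<in> ?B"
    show "(\<integral>\<^sup>+\<omega>. ennreal (\<Prod>k\<in>UNIV. ?X b k \<omega>) \<partial>M) \<le> (\<Prod>k\<in>UNIV. ennreal (?r b k))"
      unfolding prod[OF b] by (intro prod_mono_ennreal block[OF b])
  qed simp
  also have "\<dots> = (\<Sum>b\<in>?B. ennreal (?D b * (\<Prod>k\<in>UNIV. ?r b k)))"
    using r0 by (intro sum.cong) (simp_all add: prod_ennreal ennreal_mult')
  finally show ?thesis .
qed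

text \<open>The function \<open>H\<close> is the lower limit in the counting formula. By Fatou's lemma and Tonelli's theorem
its expectation is at most an integral over \<open>U\<close> of the expectations just estimated, and this
bound does not depend on the width of the Gaussian kernel. Taking \<open>K > 1\<close> with a strict inequality makes
\<open>U\<close> an open set that contains the whole closed region where all the normalized monomials are at most 1, so that zeros
on its boundary are counted as well.\<close>

lemma (in prob_space) expected_regular_zeros_chart:
  fixes A :: "'n::finite \<Rightarrow> (real ^ 'n) set"
  assumes fin: "\<And>k. finite (A k)"
    and indep: "indep_vars (\<lambda>_. borel) (\<lambda>(k, \<alpha>). f k \<alpha>) (SIGMA k:UNIV. A k)"
    and normal: "\<And>k \<alpha>. \<alpha> \<in> A k \<Longrightarrow> distributed M lborel (f k \<alpha>) (normal_density 0 (\<sigma> k \<alpha>))"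
    and \<sigma>: "\<And>k \<alpha>. \<alpha> \<in> A k \<Longrightarrow> 0 < \<sigma> k \<alpha>" "\<And>k \<alpha>. \<alpha> \<in> A k \<Longrightarrow> \<sigma> k \<alpha> \<le> 1"
    and a: "\<And>k. a k \<in> A k" "\<And>k. \<sigma> k (a k) = 1"
    and K: "1 < K"
  defines "U \<equiv> {x \<in> positive_orthant. \<forall>k. \<forall>\<alpha>\<in>A k. monomial_fun (\<alpha> - a k) x < K}"
  shows "\<exists>H \<in> borel_measurable M.
      (\<forall>\<omega>. num_elements (regular_zeros (fewnomial_system A (\<lambda>k \<alpha>. f k \<alpha> \<omega>)) positive_orthant \<inter> U) \<le> H \<omega>)
      \<and> (\<integral>\<^sup>+\<omega>. H \<omega> \<partial>M) \<le> ennreal ((K / 4) ^ CARD('n) * (\<Prod>k\<in>UNIV. real (card (A k)) - 1))"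
proof -
  let ?S = "\<lambda>\<omega>. normalized_system a A (\<lambda>k \<alpha>. f k \<alpha> \<omega>)" and ?J = "\<lambda>\<omega>. normalized_jacobian a A (\<lambda>k \<alpha>. f k \<alpha> \<omega>)"
  let ?g = "\<lambda>j \<omega> x. ennreal (\<bar>det (?J \<omega> x)\<bar> * (\<Prod>k\<in>UNIV. normal_density 0 (1 / Suc j) (?S \<omega> x $ k))) * indicator U x"
  let ?B = "PiE UNIV (\<lambda>k. A k - {a k})"
  have Upos: "U \<subseteq> positive_orthant" by (auto simp: U_def)
  have openU: "open U"
  proof -
    have "U = positive_orthant \<inter> (\<Inter>k. \<Inter>\<alpha>\<in>A k. positive_orthant \<inter> monomial_fun (\<alpha> - a k) -` {..<K})"
      by (auto simp: U_def)
    moreover have "open (positive_orthant \<inter> monomial_fun (\<alpha> - a k) -` {..<K})" for k \<alpha>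
      by (rule continuous_open_preimage[OF continuous_on_monomial_fun open_positive_orthant]) simp
    then have "open (\<Inter>k. \<Inter>\<alpha>\<in>A k. positive_orthant \<inter> monomial_fun (\<alpha> - a k) -` {..<K})"
      by (intro open_INT ballI finite fin)
    ultimately show ?thesis by (simp only: open_Int[OF open_positive_orthant])
  qed
  have Um [measurable]: "U \<in> sets borel" using openU by simp
  have fm [measurable]: "f k \<alpha> \<in> borel_measurable M" if "\<alpha> \<in> A k" for k \<alpha>
    using distributed_measurable[OF normal[OF that]] by simp
  have gm: "case_prod (?g j) \<in> borel_measurable (M \<Otimes>\<^sub>M lborel)" for j
  proof -
    have [measurable]: "(\<lambda>x :: real ^ 'n. x $ l) \<in> borel_measurable lborel" for l
      by simp
    have [measurable]: "monomial_fun \<alpha> \<in> borel_measurable lborel" for \<alpha> :: "real ^ 'n"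
      by simp
    have "(\<lambda>(\<omega>, x). ?J \<omega> x $ k $ l) \<in> borel_measurable (M \<Otimes>\<^sub>M lborel)" for k l
      unfolding normalized_jacobian_def log_gradient_def vec_lambda_beta sum_component vector_scaleR_component
        case_prod_beta
      by measurable
    moreover have "(\<lambda>(\<omega>, x). ?S \<omega> x $ k) \<in> borel_measurable (M \<Otimes>\<^sub>M lborel)" for k
      unfolding normalized_system_def vec_lambda_beta case_prod_beta by measurable
    ultimately show ?thesis
      unfolding det_def case_prod_beta by measurable
  qed
  define H where "H \<omega> = liminf (\<lambda>j. \<integral>\<^sup>+x. ?g j \<omega> x \<partial>lborel)" for \<omega>
  have Gm: "(\<lambda>\<omega>. \<integral>\<^sup>+x. ?g j \<omega> x \<partial>lborel) \<in> borel_measurable M" for j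
    by (rule lborel.borel_measurable_nn_integral[OF gm])
  have Hm: "H \<in> borel_measurable M"
    unfolding H_def using Gm by measurable
  have le: "num_elements (regular_zeros (fewnomial_system A (\<lambda>k \<alpha>. f k \<alpha> \<omega>)) positive_orthant \<inter> U) \<le> H \<omega>" for \<omega>
  proof -
    have "num_elements (regular_zeros (fewnomial_system A (\<lambda>k \<alpha>. f k \<alpha> \<omega>)) positive_orthant \<inter> U)
        \<le> emeasure (count_space UNIV) {x \<in> U. ?S \<omega> x = 0 \<and> det (?J \<omega> x) \<noteq> 0}"
      unfolding num_elements_def
      by (rule emeasure_mono) (auto simp: regular_zeros_def regular_zero_normalized)
    also have "\<dots> \<le> H \<omega>"
      unfolding H_def using Upos
      by (intro count_regular_zeros_le_liminf openU has_derivative_normalized_system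
          continuous_on_subset[OF continuous_on_normalized_jacobian]) auto
    finally show ?thesis .
  qed
  let ?h = "\<lambda>b x. ennreal (\<bar>det (\<chi> k. log_gradient (b k - a k) x)\<bar>
        * (\<Prod>k\<in>UNIV. K / pi * ((\<sigma> k (b k) * monomial_fun (b k - a k) x / K) / (1 + (\<sigma> k (b k) * monomial_fun (b k - a k) x / K)\<^sup>2))))"
  have card: "real (card ?B) = (\<Prod>k\<in>UNIV. real (card (A k)) - 1)"
  proof -
    have "real (card (A k - {a k})) = real (card (A k)) - 1" for k
      using fin[of k] a(1)[of k] card_gt_0_iff[of "A k"] by (auto simp: card_Diff_singleton of_nat_diff)
    then show ?thesis by (simp add: card_PiE)
  qed
  have G_le: "(\<integral>\<^sup>+\<omega>. \<integral>\<^sup>+x. ?g j \<omega> x \<partial>lborel \<partial>M) \<le> ennreal ((K / 4) ^ CARD('n) * (\<Prod>k\<in>UNIV. real (card (A k)) - 1))" for j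
  proof -
    interpret pair_sigma_finite M "lborel :: (real ^ 'n) measure" ..
    have "(\<integral>\<^sup>+\<omega>. \<integral>\<^sup>+x. ?g j \<omega> x \<partial>lborel \<partial>M) = (\<integral>\<^sup>+x. \<integral>\<^sup>+\<omega>. ?g j \<omega> x \<partial>M \<partial>lborel)"
      by (rule Fubini'[OF gm, symmetric])
    also have "\<dots> \<le> (\<integral>\<^sup>+x. (\<Sum>b\<in>?B. ?h b x * indicator U x) \<partial>lborel)"
    proof (rule nn_integral_mono)
      fix x
      show "(\<integral>\<^sup>+\<omega>. ?g j \<omega> x \<partial>M) \<le> (\<Sum>b\<in>?B. ?h b x * indicator U x)"
      proof (cases "x \<in> U")
        case True
        then have "x \<in> positive_orthant" "\<And>k \<alpha>. \<alpha> \<in> A k \<Longrightarrow> monomial_fun (\<alpha> - a k) x \<le> K"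
          by (auto simp: U_def less_imp_le)
        then show ?thesis
          using expectation_normalized_jacobian_le[OF fin indep normal \<sigma> a, of x K "1 / Suc j"] K True by simp
      qed simp
    qed
    also have "\<dots> = (\<Sum>b\<in>?B. \<integral>\<^sup>+x\<in>U. ?h b x \<partial>lborel)"
    proof (rule nn_integral_sum)
      fix b
      have "(\<lambda>x. ((\<chi> k. log_gradient (b k - a k) x) :: real^'n^'n) $ k $ l) \<in> borel_measurable borel" for k l
        unfolding log_gradient_def by simp
      then show "(\<lambda>x. ?h b x * indicator U x) \<in> borel_measurable lborel"
        unfolding det_def by measurable
    qed
    also have "\<dots> \<le> (\<Sum>b\<in>?B. ennreal ((K / 4) ^ CARD('n)))"
    proof (rule sum_mono)
      fix b assume b: "b \<in> ?B"
      then have bk: "b k \<in> A k" for k by auto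
      show "(\<integral>\<^sup>+x\<in>U. ?h b x \<partial>lborel) \<le> ennreal ((K / 4) ^ CARD('n))"
      proof (rule nn_integral_monomial_chart_le[OF openU Upos])
        fix x k assume x: "x \<in> U"
        then have "\<sigma> k (b k) * monomial_fun (b k - a k) x \<le> 1 * K"
          using bk[of k] \<sigma>[OF bk[of k]] K monomial_fun_pos[of x "b k - a k"]
          by (intro mult_mono) (auto simp: U_def less_imp_le)
        then show "\<sigma> k (b k) * monomial_fun (b k - a k) x \<le> K" by simp
      qed (use K \<sigma>(1)[OF bk] in auto)
    qed
    also have "\<dots> = ennreal ((K / 4) ^ CARD('n) * (\<Prod>k\<in>UNIV. real (card (A k)) - 1))"
      using K unfolding card[symmetric]
      by (simp add: ennreal_mult ennreal_of_nat_eq_real_of_nat mult.commute)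
    finally show ?thesis .
  qed
  have "(\<integral>\<^sup>+\<omega>. H \<omega> \<partial>M) \<le> liminf (\<lambda>j. \<integral>\<^sup>+\<omega>. \<integral>\<^sup>+x. ?g j \<omega> x \<partial>lborel \<partial>M)"
    unfolding H_def by (rule nn_integral_liminf[OF Gm])
  also have "\<dots> \<le> ennreal ((K / 4) ^ CARD('n) * (\<Prod>k\<in>UNIV. real (card (A k)) - 1))"
    by (intro Liminf_le always_eventually allI G_le sequentially_bot)
  finally show ?thesis using Hm le by blast
qed

section \<open>Vertices of Minkowski sums and the covering by charts\<close>

lemma sum_in_Minkowski_sum:
  fixes P :: "'n::finite \<Rightarrow> 'a::comm_monoid_add set"
  assumes "\<And>k. s k \<in> P k"
  shows "(\<Sum>k\<in>UNIV. s k) \<in> (\<Sum>k\<in>UNIV. P k)"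
  using assms by (subst set_sum_alt) auto

lemma sum_fun_upd:
  fixes s :: "'n::finite \<Rightarrow> 'a::ab_group_add"
  shows "(\<Sum>j\<in>UNIV. (s(k := c)) j) = (\<Sum>j\<in>UNIV. s j) - s k + c"
  by (simp add: sum.remove[of UNIV k] fun_upd_def)

text \<open>A segment through \<open>s k\<close> inside \<open>P k\<close>, translated by the other summands, is a segment through \<open>p\<close>
inside the sum.\<close>

lemma vertex_of_Minkowski_sum_summands:
  fixes P :: "'n::finite \<Rightarrow> 'a::euclidean_space set"
  assumes p: "p extreme_point_of (\<Sum>k\<in>UNIV. P k)"
    and s: "\<And>k. s k \<in> P k" and sum: "p = (\<Sum>k\<in>UNIV. s k)"
  shows "s k extreme_point_of P k"
  unfolding extreme_point_of_def
proof (intro conjI ballI notI)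
  have upd: "(\<Sum>j\<in>UNIV. s j) - s k + c \<in> (\<Sum>j\<in>UNIV. P j)" if "c \<in> P k" for c
    unfolding sum_fun_upd[symmetric] using s that by (intro sum_in_Minkowski_sum) simp
  show "s k \<in> P k" by (rule s)
  fix c d assume cd: "c \<in> P k" "d \<in> P k" "s k \<in> open_segment c d"
  then have "p \<in> open_segment ((\<Sum>j\<in>UNIV. s j) - s k + c) ((\<Sum>j\<in>UNIV. s j) - s k + d)"
    unfolding open_segment_translation sum by (intro image_eqI[of _ _ "s k"]) auto
  then show False
    using p upd[OF cd(1)] upd[OF cd(2)] by (auto simp: extreme_point_of_def)
qed

lemma Minkowski_sum_convex_hull:
  fixes A :: "'n::finite \<Rightarrow> 'a::euclidean_space set"
  assumes "\<And>k. finite (A k)"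
  shows "compact (\<Sum>k\<in>UNIV. convex hull (A k))" "convex (\<Sum>k\<in>UNIV. convex hull (A k))"
    and "finite (polytope_vertices (\<Sum>k\<in>UNIV. convex hull (A k)))"
proof -
  have eq: "(\<Sum>k\<in>UNIV. convex hull (A k)) = convex hull (\<Sum>k\<in>UNIV. A k)"
    by (rule convex_hull_set_sum[symmetric])
  have fin: "finite (\<Sum>k\<in>UNIV. A k)"
    using assms by (intro finite_set_sum) auto
  show "compact (\<Sum>k\<in>UNIV. convex hull (A k))" "convex (\<Sum>k\<in>UNIV. convex hull (A k))"
    unfolding eq using fin by (simp_all add: finite_imp_compact_convex_hull)
  show "finite (polytope_vertices (\<Sum>k\<in>UNIV. convex hull (A k)))"
    unfolding eq polytope_vertices_def
    by (rule finite_subset[OF _ fin]) (auto dest: extreme_point_of_convex_hull)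
qed

text \<open>The maximizers form a compact face, and extreme points of a face are extreme points of \<open>P\<close>.\<close>

lemma vertex_maximizes_linear_functional:
  fixes P :: "'a::euclidean_space set"
  assumes P: "compact P" "convex P" "P \<noteq> {}"
  shows "\<exists>p\<in>polytope_vertices P. \<forall>q\<in>P. y \<bullet> q \<le> y \<bullet> p"
proof -
  have "continuous_on P ((\<bullet>) y)" by (intro continuous_intros)
  then obtain m where m: "m \<in> P" "\<And>q. q \<in> P \<Longrightarrow> y \<bullet> q \<le> y \<bullet> m"
    using continuous_attains_sup[OF P(1,3)] by blast
  let ?F = "P \<inter> {q. y \<bullet> q = y \<bullet> m}"
  have face: "?F face_of P"
    by (rule face_of_Int_supporting_hyperplane_le[OF P(2) m(2)])
  have "compact ?F" "convex ?F" "?F \<noteq> {}"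
    using P m(1) face by (auto intro: compact_Int_closed closed_hyperplane dest: face_of_imp_convex)
  then obtain p where "p extreme_point_of ?F"
    by (rule extreme_point_exists_convex)
  then have "p extreme_point_of P" "y \<bullet> p = y \<bullet> m"
    using extreme_point_of_face[OF face] by auto
  then show ?thesis using m(2) by (auto simp: polytope_vertices_def intro!: bexI[of _ p])
qed

text \<open>The regions where the normalized monomials are at most 1 cover the orthant: for a given \<open>x\<close> one
takes a vertex at which the linear functional with vector \<open>ln x\<close> is maximal on the sum. Changing a single summand
shows that \<open>a p k\<close> maximizes it on \<open>A k\<close>.\<close>

lemma Minkowski_sum_vertex_charts:
  fixes A :: "'n::finite \<Rightarrow> (real ^ 'n) set"
  assumes fin: "\<And>k. finite (A k)" and ne: "\<And>k. A k \<noteq> {}"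
  shows "\<exists>a. (\<forall>p\<in>polytope_vertices (\<Sum>k\<in>UNIV. convex hull (A k)).
        \<forall>k. a p k \<in> A k \<and> a p k \<in> polytope_vertices (convex hull (A k)))
      \<and> (\<forall>x\<in>positive_orthant. \<exists>p\<in>polytope_vertices (\<Sum>k\<in>UNIV. convex hull (A k)).
        \<forall>k. \<forall>\<alpha>\<in>A k. monomial_fun (\<alpha> - a p k) x \<le> 1)"
proof -
  let ?P = "\<Sum>k\<in>UNIV. convex hull (A k)"
  let ?V = "polytope_vertices ?P"
  have "\<forall>p\<in>?V. \<exists>s. (\<forall>k. s k \<in> convex hull (A k)) \<and> p = (\<Sum>k\<in>UNIV. s k)"
    by (auto simp: polytope_vertices_def extreme_point_of_def set_sum_alt)
  from bchoice[OF this] obtain a where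
    "\<forall>p\<in>?V. (\<forall>k. a p k \<in> convex hull (A k)) \<and> p = (\<Sum>k\<in>UNIV. a p k)" by blast
  then have a: "\<And>p k. p \<in> ?V \<Longrightarrow> a p k \<in> convex hull (A k)" "\<And>p. p \<in> ?V \<Longrightarrow> p = (\<Sum>k\<in>UNIV. a p k)"
    by blast+
  have ext: "a p k extreme_point_of (convex hull (A k))" if "p \<in> ?V" for p k
    using that by (intro vertex_of_Minkowski_sum_summands[OF _ a(1)[OF that] a(2)[OF that]])
      (simp add: polytope_vertices_def)
  show ?thesis
  proof (intro exI[of _ a] conjI ballI allI)
    fix p k assume p: "p \<in> ?V"
    show "a p k \<in> A k"
      by (rule extreme_point_of_convex_hull[OF ext[OF p]])
    show "a p k \<in> polytope_vertices (convex hull (A k))"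
      using ext[OF p] by (simp add: polytope_vertices_def)
  next
    fix x :: "real ^ 'n" assume x: "x \<in> positive_orthant"
    \<comment> \<open>Monomials are exponentials of linear functionals of this vector.\<close>
    let ?y = "\<chi> l. ln (x $ l)"
    have "(SOME \<alpha>. \<alpha> \<in> A k) \<in> convex hull (A k)" for k
      using ne[of k] by (intro hull_inc) (simp add: some_in_eq)
    then have "(\<Sum>k\<in>UNIV. SOME \<alpha>. \<alpha> \<in> A k) \<in> ?P"
      by (rule sum_in_Minkowski_sum)
    then have "?P \<noteq> {}" by blast
    then have "\<exists>p\<in>?V. \<forall>q\<in>?P. ?y \<bullet> q \<le> ?y \<bullet> p"
      by (rule vertex_maximizes_linear_functional[OF Minkowski_sum_convex_hull(1,2)[OF fin]])
    then obtain p where p: "p \<in> ?V" "\<forall>q\<in>?P. ?y \<bullet> q \<le> ?y \<bullet> p" ..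
    have "monomial_fun (\<alpha> - a p k) x \<le> 1" if \<alpha>: "\<alpha> \<in> A k" for k \<alpha>
    proof -
      have "(\<Sum>j\<in>UNIV. ((a p)(k := \<alpha>)) j) \<in> ?P"
        using a(1)[OF p(1)] hull_inc[OF \<alpha>] by (intro sum_in_Minkowski_sum) auto
      moreover have "(\<Sum>j\<in>UNIV. ((a p)(k := \<alpha>)) j) = p - a p k + \<alpha>"
        unfolding sum_fun_upd by (simp only: a(2)[OF p(1), symmetric])
      ultimately have "p - a p k + \<alpha> \<in> ?P" by (simp only:)
      from bspec[OF p(2) this] have "?y \<bullet> \<alpha> \<le> ?y \<bullet> a p k"
        by (simp add: inner_diff_right inner_add_right)
      then have "(\<alpha> - a p k) \<bullet> ?y \<le> 0"
        by (simp add: inner_diff_right inner_commute[of _ ?y])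
      then show ?thesis by (simp add: monomial_fun_eq_exp[OF x])
    qed
    then show "\<exists>p\<in>?V. \<forall>k. \<forall>\<alpha>\<in>A k. monomial_fun (\<alpha> - a p k) x \<le> 1" using p(1) by blast
  qed
qed

section \<open>The bound on the expected number of regular zeros\<close>

theorem theorem1p3:
  fixes M :: "'w measure"
    and A :: "'n::finite \<Rightarrow> (real ^ 'n) set"
    and v :: "'n \<Rightarrow> real ^ 'n \<Rightarrow> real"
    and f :: "'n \<Rightarrow> real ^ 'n \<Rightarrow> 'w \<Rightarrow> real"
  assumes "prob_space M"
    and "\<And>k. finite (A k)"
    and "\<And>k. A k \<noteq> {}"
    and indep: "prob_space.indep_vars M (\<lambda>_. borel) (\<lambda>(k, \<alpha>). f k \<alpha>) (SIGMA k:UNIV. A k)"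
    and var_pos: "\<And>k \<alpha>. \<alpha> \<in> A k \<Longrightarrow> v k \<alpha> > 0"
    and gaussian: "\<And>k \<alpha>. \<alpha> \<in> A k \<Longrightarrow>
           distributed M lborel (f k \<alpha>) (normal_density 0 (sqrt (v k \<alpha>)))"
    and VM1: "\<And>k \<alpha>. \<alpha> \<in> A k \<Longrightarrow> v k \<alpha> \<le> 1"
    and VM2: "\<And>k \<alpha>. \<alpha> \<in> A k \<Longrightarrow> \<alpha> \<in> polytope_vertices (convex hull (A k)) \<Longrightarrow> v k \<alpha> = 1"
  shows "(\<integral>\<^sup>+ \<omega>. num_elements (regular_zeros (fewnomial_system A (\<lambda>k \<alpha>. f k \<alpha> \<omega>)) positive_orthant) \<partial>M)
         \<le> ennreal (1 / 4 ^ CARD('n)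
             * real (card (polytope_vertices (\<Sum>k\<in>UNIV. convex hull (A k))))
             * (\<Prod>k\<in>UNIV. real (card (A k)) - 1))"
proof -
  interpret prob_space M by fact
  let ?V = "polytope_vertices (\<Sum>k\<in>UNIV. convex hull (A k))"
  let ?Z = "\<lambda>\<omega>. regular_zeros (fewnomial_system A (\<lambda>k \<alpha>. f k \<alpha> \<omega>)) positive_orthant"
  let ?T = "\<Prod>k\<in>UNIV. real (card (A k)) - 1"
  let ?C = "1 / 4 ^ CARD('n) * real (card ?V) * ?T"
  let ?L = "\<integral>\<^sup>+ \<omega>. num_elements (?Z \<omega>) \<partial>M"
  from Minkowski_sum_vertex_charts[OF assms(2,3)] obtain a where
    "(\<forall>p\<in>?V. \<forall>k. a p k \<in> A k \<and> a p k \<in> polytope_vertices (convex hull (A k)))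
      \<and> (\<forall>x\<in>positive_orthant. \<exists>p\<in>?V. \<forall>k. \<forall>\<alpha>\<in>A k. monomial_fun (\<alpha> - a p k) x \<le> 1)" ..
  then have a: "\<And>p k. p \<in> ?V \<Longrightarrow> a p k \<in> A k"
      "\<And>p k. p \<in> ?V \<Longrightarrow> a p k \<in> polytope_vertices (convex hull (A k))"
      "\<And>x. x \<in> positive_orthant \<Longrightarrow> \<exists>p\<in>?V. \<forall>k. \<forall>\<alpha>\<in>A k. monomial_fun (\<alpha> - a p k) x \<le> 1"
    by blast+
  have finV: "finite ?V" by (rule Minkowski_sum_convex_hull(3)[OF assms(2)])
  \<comment> \<open>Zeros in overlaps of charts are counted more than once, which only increases the sum.\<close>
  have bound: "?L \<le> ennreal (K ^ CARD('n) * ?C)" if K: "1 < K" for K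
  proof -
    define U where "U p = {x \<in> positive_orthant. \<forall>k. \<forall>\<alpha>\<in>A k. monomial_fun (\<alpha> - a p k) x < K}" for p
    have "\<forall>p\<in>?V. \<exists>H. H \<in> borel_measurable M \<and> (\<forall>\<omega>. num_elements (?Z \<omega> \<inter> U p) \<le> H \<omega>)
        \<and> (\<integral>\<^sup>+\<omega>. H \<omega> \<partial>M) \<le> ennreal ((K / 4) ^ CARD('n) * ?T)"
    proof
      fix p assume p: "p \<in> ?V"
      have "sqrt (v k (a p k)) = 1" for k using VM2 a(1,2)[OF p] by simp
      moreover have "0 < sqrt (v k \<alpha>)" "sqrt (v k \<alpha>) \<le> 1" if "\<alpha> \<in> A k" for k \<alpha>
        using var_pos[OF that] VM1[OF that] by simp_all
      ultimately have "\<exists>H\<in>borel_measurable M. (\<forall>\<omega>. num_elements (?Z \<omega> \<inter> U p) \<le> H \<omega>)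
        \<and> (\<integral>\<^sup>+\<omega>. H \<omega> \<partial>M) \<le> ennreal ((K / 4) ^ CARD('n) * ?T)"
        unfolding U_def
        by (intro expected_regular_zeros_chart[where \<sigma> = "\<lambda>k \<alpha>. sqrt (v k \<alpha>)"] assms(2) indep gaussian a(1)[OF p] K)
      then show "\<exists>H. H \<in> borel_measurable M \<and> (\<forall>\<omega>. num_elements (?Z \<omega> \<inter> U p) \<le> H \<omega>)
        \<and> (\<integral>\<^sup>+\<omega>. H \<omega> \<partial>M) \<le> ennreal ((K / 4) ^ CARD('n) * ?T)"
        by (simp only: Bex_def)
    qed
    from bchoice[OF this] obtain H where
      "\<forall>p\<in>?V. H p \<in> borel_measurable M \<and> (\<forall>\<omega>. num_elements (?Z \<omega> \<inter> U p) \<le> H p \<omega>)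
        \<and> (\<integral>\<^sup>+\<omega>. H p \<omega> \<partial>M) \<le> ennreal ((K / 4) ^ CARD('n) * ?T)" ..
    then have H: "\<And>p. p \<in> ?V \<Longrightarrow> H p \<in> borel_measurable M"
        "\<And>p \<omega>. p \<in> ?V \<Longrightarrow> num_elements (?Z \<omega> \<inter> U p) \<le> H p \<omega>"
        "\<And>p. p \<in> ?V \<Longrightarrow> (\<integral>\<^sup>+\<omega>. H p \<omega> \<partial>M) \<le> ennreal ((K / 4) ^ CARD('n) * ?T)"
      by blast+
    have "?L \<le> (\<integral>\<^sup>+\<omega>. (\<Sum>p\<in>?V. H p \<omega>) \<partial>M)"
    proof (rule nn_integral_mono)
      fix \<omega>
      have "?Z \<omega> \<subseteq> (\<Union>p\<in>?V. ?Z \<omega> \<inter> U p)"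
      proof
        fix x assume x: "x \<in> ?Z \<omega>"
        then have pos: "x \<in> positive_orthant" by (simp add: regular_zeros_def)
        show "x \<in> (\<Union>p\<in>?V. ?Z \<omega> \<inter> U p)"
        proof -
          obtain p where p: "p \<in> ?V" "\<forall>k. \<forall>\<alpha>\<in>A k. monomial_fun (\<alpha> - a p k) x \<le> 1"
            using a(3)[OF pos] ..
          then have "x \<in> U p"
            using K pos unfolding U_def by (auto intro: le_less_trans)
          then show ?thesis using p(1) x by blast
        qed
      qed
      then have "num_elements (?Z \<omega>) \<le> num_elements (\<Union>p\<in>?V. ?Z \<omega> \<inter> U p)"
        unfolding num_elements_def by (intro emeasure_mono) auto
      also have "\<dots> \<le> (\<Sum>p\<in>?V. num_elements (?Z \<omega> \<inter> U p))"
        unfolding num_elements_def using finV by (intro emeasure_subadditive_finite) auto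
      also have "\<dots> \<le> (\<Sum>p\<in>?V. H p \<omega>)" by (intro sum_mono H)
      finally show "num_elements (?Z \<omega>) \<le> (\<Sum>p\<in>?V. H p \<omega>)" .
    qed
    also have "\<dots> = (\<Sum>p\<in>?V. \<integral>\<^sup>+\<omega>. H p \<omega> \<partial>M)"
      by (intro nn_integral_sum H)
    also have "\<dots> \<le> (\<Sum>p\<in>?V. ennreal ((K / 4) ^ CARD('n) * ?T))"
      by (intro sum_mono H)
    also have "\<dots> = ennreal (real (card ?V) * ((K / 4) ^ CARD('n) * ?T))"
      by (simp add: ennreal_mult' ennreal_of_nat_eq_real_of_nat)
    also have "real (card ?V) * ((K / 4) ^ CARD('n) * ?T) = K ^ CARD('n) * ?C"
      by (simp add: power_divide)
    finally show ?thesis .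
  qed
  \<comment> \<open>The bound holds for every \<open>K > 1\<close>, hence for \<open>K = 1\<close>.\<close>
  have "(\<lambda>j. (1 + inverse (real (Suc j))) ^ CARD('n) * ?C) \<longlonglongrightarrow> (1 + 0) ^ CARD('n) * ?C"
    by (intro tendsto_intros LIMSEQ_inverse_real_of_nat)
  then have "(\<lambda>j. ennreal ((1 + inverse (real (Suc j))) ^ CARD('n) * ?C)) \<longlonglongrightarrow> ennreal ?C"
    by (intro tendsto_ennrealI) simp
  then show ?thesis
    by (rule LIMSEQ_le_const) (intro exI[of _ 0] allI impI bound, simp)
qed

end
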